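(* Let $\mathcal{A}$ be a central simple structurable division algebra over a field $k$ of characteristic $\neq 2,3$. Then $\mathcal{A}$ is algebraic.
   Context: Structurable algebras. A structurable algebra over $k$ is a finite-dimensional unital (not necessarily associative or commutative) $k$-algebra $\mathcal{A}$ with an involution $x\mapsto\bar x$ (a $k$-linear map of order at most two with $\overline{xy}=\bar y\,\bar x$) such that $[V_{x,y},V_{z,w}]=V_{\{x,y,z\},w}-V_{z,\{y,x,w\}}$ for all $x,y,z,w$, where $V_{x,y}z=\{x,y,z\}=(x\bar y)z+(z\bar y)x-(z\bar x)y$. Put $\mathcal{H}=\{h\mid\bar h=h\}$, $\mathcal{S}=\{s\mid\bar s=-s\}$, $\psi(x,y)=x\bar y-y\bar x\in\mathcal{S}$, and $L_sx=sx$ for $s\in\mathcal{S}$. $\mathcal{A}$ is simple if its only two-sided ideals stable under the involution are $0$ and $\mathcal{A}$, and central if $Z(\mathcal{A})\cap\mathcal{H}=k1$, where $Z(\mathcal{A})$ is the set of elements commuting and associating with all of $\mathcal{A}$. An element $u$ is conjugate invertible if there is $\hat u\in\mathcal{A}$ with $V_{u,\hat u}=\mathrm{id}$; $\mathcal{A}$ is a structurable division algebra if every nonzero element is conjugate invertible. The Lie algebra $K(\mathcal{A})$. Let $\mathrm{Instrl}(\mathcal{A})=\mathrm{span}\{V_{x,y}\}$. Then $K(\mathcal{A})=\mathcal{S}_-\oplus\mathcal{A}_-\oplus\mathrm{Instrl}(\mathcal{A})\oplus\mathcal{A}_+\oplus\mathcal{S}_+$ (copies of $\mathcal S,\mathcal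 A$; graded pieces of degrees $-2,-1,0,1,2$), with the commutator on $\mathrm{Instrl}(\mathcal{A})$ and $[V_{a,b},x_+]=(V_{a,b}x)_+$, $[V_{a,b},y_-]=(-V_{b,a}y)_-$, $[V_{a,b},s_+]=-\psi(a,sb)_+$, $[V_{a,b},t_-]=\psi(b,ta)_-$, $[s_+,x_+]=0=[t_-,y_-]$, $[s_+,y_-]=(sy)_+$, $[t_-,x_+]=(tx)_-$, $[x_+,y_-]=V_{x,y}$, $[x_+,x'_+]=\psi(x,x')_+$, $[y_-,y'_-]=\psi(y,y')_-$, $[s_+,s'_+]=[t_-,t'_-]=0$, $[s_+,t_-]=L_sL_t\in\mathrm{Instrl}(\mathcal A)$. Algebraicity. For a finite-dimensional 5-graded Lie algebra $\mathcal{L}=\bigoplus_{i=-2}^2\mathcal{L}_i$, $\sigma\in\{1,-1\}$ and $(x,s)\in\mathcal{L}_\sigma\oplus\mathcal{L}_{2\sigma}$, put $e_\sigma(x,s)=\sum_{i=0}^4\frac1{i!}\mathrm{ad}(x+s)^i$. $\mathcal{L}$ is algebraic if all $e_\sigma(x,s)$ are Lie algebra automorphisms. $\mathcal{A}$ is algebraic if $K(\mathcal{A})$ is. *)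

theory Defs
  imports Complex_Main "HOL-Library.Function_Algebras" "HOL-Library.Product_Plus"
begin

definition lie_automorphism ::
  "('k \<Rightarrow> 'l \<Rightarrow> 'l) \<Rightarrow> 'l::ab_group_add set \<Rightarrow> ('l \<Rightarrow> 'l \<Rightarrow> 'l) \<Rightarrow> ('l \<Rightarrow> 'l) \<Rightarrow> bool" where
  "lie_automorphism sc L br f \<longleftrightarrow>
     bij_betw f L L \<and>
     (\<forall>x\<in>L. \<forall>y\<in>L. f (x + y) = f x + f y) \<and>
     (\<forall>c. \<forall>x\<in>L. f (sc c x) = sc c (f x)) \<and>
     (\<forall>x\<in>L. \<forall>y\<in>L. f (br x y) = br (f x) (f y))"

text \<open>A 5-grading is given by its homogeneous components \<open>Lg i\<close>, \<open>-2 \<le> i \<le> 2\<close>.\<close>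

definition graded_carrier :: "(int \<Rightarrow> 'l::ab_group_add set) \<Rightarrow> 'l set" where
  "graded_carrier Lg = {\<Sum>i=-2..2. f i | f. \<forall>i\<in>{-2..2}. f i \<in> Lg i}"

definition exp_ad ::
  "('k::field \<Rightarrow> 'l \<Rightarrow> 'l) \<Rightarrow> ('l \<Rightarrow> 'l \<Rightarrow> 'l) \<Rightarrow> 'l \<Rightarrow> 'l \<Rightarrow> 'l::ab_group_add" where
  "exp_ad sc br z w = (\<Sum>i\<le>4. sc (1 / of_nat (fact i)) ((br z ^^ i) w))"

definition algebraic_5_graded ::
  "('k::field \<Rightarrow> 'l \<Rightarrow> 'l) \<Rightarrow> (int \<Rightarrow> 'l::ab_group_add set) \<Rightarrow> ('l \<Rightarrow> 'l \<Rightarrow> 'l) \<Rightarrow> bool" where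
  "algebraic_5_graded sc Lg br \<longleftrightarrow>
     (\<forall>\<sigma>\<in>{1, -1}. \<forall>x\<in>Lg \<sigma>. \<forall>s\<in>Lg (2 * \<sigma>).
        lie_automorphism sc (graded_carrier Lg) br (exp_ad sc br (x + s)))"


locale algebra_with_involution = vector_space scale
  for scale :: "'k::field \<Rightarrow> 'a::ab_group_add \<Rightarrow> 'a" (infixr "*s" 75) +
  fixes mult :: "'a \<Rightarrow> 'a \<Rightarrow> 'a" (infixl "\<cdot>" 70)
    and one :: "'a" ("\<one>")
    and cnj :: "'a \<Rightarrow> 'a"
  assumes finite_dim: "\<exists>B. finite B \<and> span B = UNIV"
    and mult_add_left: "(x + y) \<cdot> z = x \<cdot> z + y \<cdot> z"
    and mult_add_right: "x \<cdot> (y + z) = x \<cdot> y + x \<cdot> z"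
    and mult_scale_left: "(c *s x) \<cdot> y = c *s (x \<cdot> y)"
    and mult_scale_right: "x \<cdot> (c *s y) = c *s (x \<cdot> y)"
    and one_mult: "\<one> \<cdot> x = x"
    and mult_one: "x \<cdot> \<one> = x"
    and cnj_add: "cnj (x + y) = cnj x + cnj y"
    and cnj_scale: "cnj (c *s x) = c *s cnj x"
    and cnj_cnj: "cnj (cnj x) = x"
    and cnj_mult: "cnj (x \<cdot> y) = cnj y \<cdot> cnj x"
begin

definition V :: "'a \<Rightarrow> 'a \<Rightarrow> 'a \<Rightarrow> 'a" where
  "V x y z = (x \<cdot> cnj y) \<cdot> z + (z \<cdot> cnj y) \<cdot> x - (z \<cdot> cnj x) \<cdot> y"

definition Herm :: "'a set" where "Herm = {h. cnj h = h}"

definition Skew :: "'a set" where "Skew = {s. cnj s = - s}"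

definition \<psi> :: "'a \<Rightarrow> 'a \<Rightarrow> 'a" where "\<psi> x y = x \<cdot> cnj y - y \<cdot> cnj x"

definition Center :: "'a set" where
  "Center = {z. \<forall>x y. z \<cdot> x = x \<cdot> z \<and> (z \<cdot> x) \<cdot> y = z \<cdot> (x \<cdot> y) \<and>
                      (x \<cdot> z) \<cdot> y = x \<cdot> (z \<cdot> y) \<and> (x \<cdot> y) \<cdot> z = x \<cdot> (y \<cdot> z)}"

definition central :: bool where
  "central \<longleftrightarrow> Center \<inter> Herm = range (\<lambda>c. c *s \<one>)"

definition stable_ideal :: "'a set \<Rightarrow> bool" where
  "stable_ideal I \<longleftrightarrow> subspace I \<and> (\<forall>x\<in>I. \<forall>a. a \<cdot> x \<in> I \<and> x \<cdot> a \<in> I) \<and> cnj ` I \<subseteq> I"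

definition simple :: bool where
  "simple \<longleftrightarrow> (\<forall>I. stable_ideal I \<longrightarrow> I = {0} \<or> I = UNIV)"

definition conj_invertible :: "'a \<Rightarrow> bool" where
  "conj_invertible u \<longleftrightarrow> (\<exists>u'. V u u' = id)"

definition division :: bool where
  "division \<longleftrightarrow> (\<forall>u. u \<noteq> 0 \<longrightarrow> conj_invertible u)"

definition fun_scale :: "'k \<Rightarrow> ('a \<Rightarrow> 'a) \<Rightarrow> 'a \<Rightarrow> 'a" where
  "fun_scale c f = (\<lambda>z. c *s f z)"

definition Instrl :: "('a \<Rightarrow> 'a) set" where
  "Instrl = module.span fun_scale {V x y | x y. True}"

text \<open>
  The brackets of \<open>Instrl\<close> with three of the other four summands are prescribed only on the
  spanning set of all \<open>V a b\<close>. \<open>V_extension \<phi>\<close> is a linear map sending \<open>V a b\<close> to \<open>\<phi> a b\<close>; its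
  values on \<open>Instrl\<close> do not depend on the choice. That such a map exists for each \<open>\<phi>\<close> used below is
  proved in \<open>act_minus1_V\<close>, \<open>act_plus2_V\<close> and \<open>act_minus2_V\<close> (the last two for skew
  arguments, in a structurable algebra of characteristic different from 2 and 3).
\<close>

definition V_extension :: "('a \<Rightarrow> 'a \<Rightarrow> 'a) \<Rightarrow> ('a \<Rightarrow> 'a) \<Rightarrow> 'a" where
  "V_extension \<phi> = (SOME f. Vector_Spaces.linear fun_scale scale f \<and> (\<forall>a b. f (V a b) = \<phi> a b))"

definition act_minus1 :: "('a \<Rightarrow> 'a) \<Rightarrow> 'a \<Rightarrow> 'a" where
  "act_minus1 D y = V_extension (\<lambda>a b. - V b a y) D"

definition act_plus2 :: "('a \<Rightarrow> 'a) \<Rightarrow> 'a \<Rightarrow> 'a" where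
  "act_plus2 D s = V_extension (\<lambda>a b. - \<psi> a (s \<cdot> b)) D"

definition act_minus2 :: "('a \<Rightarrow> 'a) \<Rightarrow> 'a \<Rightarrow> 'a" where
  "act_minus2 D t = V_extension (\<lambda>a b. \<psi> b (t \<cdot> a)) D"

text \<open>
  The tuple \<open>(t, y, D, x, s)\<close> stands for \<open>t\<^sub>- + y\<^sub>- + D + x\<^sub>+ + s\<^sub>+\<close>; it belongs to \<open>K(A)\<close>
  if \<open>t, s \<in> Skew\<close> and \<open>D \<in> Instrl\<close>.
\<close>

fun K_bracket ::
  "'a \<times> 'a \<times> ('a \<Rightarrow> 'a) \<times> 'a \<times> 'a \<Rightarrow> 'a \<times> 'a \<times> ('a \<Rightarrow> 'a) \<times> 'a \<times> 'a
     \<Rightarrow> 'a \<times> 'a \<times> ('a \<Rightarrow> 'a) \<times> 'a \<times> 'a" where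
  "K_bracket (t, y, D, x, s) (t', y', D', x', s') =
    (act_minus2 D t' - act_minus2 D' t + \<psi> y y',
     act_minus1 D y' - act_minus1 D' y + t \<cdot> x' - t' \<cdot> x,
     (\<lambda>z. D (D' z) - D' (D z) + V x y' z - V x' y z + s \<cdot> (t' \<cdot> z) - s' \<cdot> (t \<cdot> z)),
     D x' - D' x + s \<cdot> y' - s' \<cdot> y,
     act_plus2 D s' - act_plus2 D' s + \<psi> x x')"

fun K_scale :: "'k \<Rightarrow> 'a \<times> 'a \<times> ('a \<Rightarrow> 'a) \<times> 'a \<times> 'a \<Rightarrow> 'a \<times> 'a \<times> ('a \<Rightarrow> 'a) \<times> 'a \<times> 'a" where
  "K_scale c (t, y, D, x, s) = (c *s t, c *s y, fun_scale c D, c *s x, c *s s)"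

definition K_grading :: "int \<Rightarrow> ('a \<times> 'a \<times> ('a \<Rightarrow> 'a) \<times> 'a \<times> 'a) set" where
  "K_grading i =
    (if i = -2 then {(t, 0, 0, 0, 0) | t. t \<in> Skew}
     else if i = -1 then {(0, y, 0, 0, 0) | y. True}
     else if i = 0 then {(0, 0, D, 0, 0) | D. D \<in> Instrl}
     else if i = 1 then {(0, 0, 0, x, 0) | x. True}
     else if i = 2 then {(0, 0, 0, 0, s) | s. s \<in> Skew}
     else {0})"

definition algebraic :: bool where
  "algebraic \<longleftrightarrow> algebraic_5_graded K_scale K_grading K_bracket"

end

locale structurable_algebra = algebra_with_involution scale mult one cnj
  for scale :: "'k::field \<Rightarrow> 'a::ab_group_add \<Rightarrow> 'a" (infixr "*s" 75)
    and mult (infixl "\<cdot>" 70) and one ("\<one>") and cnj +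
  assumes structurable:
    "V x y (V z w v) - V z w (V x y v) = V (V x y z) w v - V z (V y x w) v"

locale central_simple_structurable_division_algebra = structurable_algebra +
  assumes central: central and simple: simple and division: division


subsection \<open>The bracket of \<open>K(A)\<close> is well defined\<close>

context algebra_with_involution
begin

lemma mult_zero [simp]: "0 \<cdot> x = 0" "x \<cdot> 0 = 0"
  using mult_add_left[of 0 0 x] mult_add_right[of x 0 0] by auto

lemma mult_minus [simp]: "(- x) \<cdot> y = - (x \<cdot> y)" "x \<cdot> (- y) = - (x \<cdot> y)"
  using mult_add_left[of x "-x" y] mult_add_right[of x y "-y"] by (simp_all add: eq_neg_iff_add_eq_0 add.commute)

lemma mult_diff: "(x - z) \<cdot> y = x \<cdot> y - z \<cdot> y" "x \<cdot> (y - z) = x \<cdot> y - x \<cdot> z"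
  using mult_add_left[of x "-z" y] mult_add_right[of x y "-z"] by simp_all

lemma cnj_minus [simp]: "cnj (- x) = - cnj x"
  using cnj_scale[of "-1" x] by simp

lemma cnj_diff: "cnj (x - y) = cnj x - cnj y"
  using cnj_add[of x "-y"] by simp

lemma cnj_one [simp]: "cnj \<one> = \<one>"
  by (metis cnj_cnj cnj_mult one_mult)

lemmas alg_simps = V_def \<psi>_def mult_add_left mult_add_right mult_diff one_mult mult_one
  cnj_add cnj_cnj cnj_mult cnj_diff

lemma fun_vector_space: "vector_space fun_scale"
  by unfold_locales
    (auto simp: fun_scale_def fun_eq_iff scale_right_distrib scale_left_distrib)

lemma V_extension_eq:
  assumes "Vector_Spaces.linear fun_scale scale f" "\<And>a b. f (V a b) = \<phi> a b"
  shows "V_extension \<phi> (V a b) = \<phi> a b"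
  unfolding V_extension_def
  by (rule someI2[of _ f]) (use assms in auto)

lemma linear_fun_scaleI:
  assumes "\<And>f g. F (f + g) = F f + F g" "\<And>c f. F (fun_scale c f) = c *s F f"
  shows "Vector_Spaces.linear fun_scale scale F"
proof -
  interpret funs: vector_space fun_scale by (rule fun_vector_space)
  show ?thesis by unfold_locales (use assms in auto)
qed

lemma act_minus1_V: "act_minus1 (V a b) y = - V b a y"
  unfolding act_minus1_def
  by (rule V_extension_eq[where f = "\<lambda>D. D y - (D \<one> + cnj (D \<one>)) \<cdot> y"], rule linear_fun_scaleI)
    (simp_all add: fun_scale_def alg_simps cnj_scale mult_scale_left scale_right_diff_distrib
      scale_right_distrib)

lemma V_swap: "V x z y - V y z x = \<psi> x y \<cdot> z"
  by (simp add: alg_simps)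

definition assoc :: "'a \<Rightarrow> 'a \<Rightarrow> 'a \<Rightarrow> 'a" where
  "assoc x y z = (x \<cdot> y) \<cdot> z - x \<cdot> (y \<cdot> z)"

lemma assoc_add:
  "assoc (x + x') y z = assoc x y z + assoc x' y z"
  "assoc x (y + y') z = assoc x y z + assoc x y' z"
  "assoc x y (z + z') = assoc x y z + assoc x y z'"
  "assoc (x - x') y z = assoc x y z - assoc x' y z"
  "assoc x (y - y') z = assoc x y z - assoc x y' z"
  "assoc x y (z - z') = assoc x y z - assoc x y z'"
  "assoc (- x) y z = - assoc x y z"
  "assoc x (- y) z = - assoc x y z"
  "assoc x y (- z) = - assoc x y z"
  by (simp_all add: assoc_def mult_add_left mult_add_right mult_diff algebra_simps)

lemma cnj_assoc: "cnj (assoc x y z) = - assoc (cnj z) (cnj y) (cnj x)"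
  by (simp add: assoc_def cnj_diff cnj_mult)

lemma double_cancel:
  assumes "(2::'k) \<noteq> 0" "u + u = v + (v::'a)"
  shows "u = v"
proof -
  have "2 *s u = 2 *s v"
    using assms(2) scale_left_distrib[of 1 1 u] scale_left_distrib[of 1 1 v] by simp
  with assms(1) show ?thesis by simp
qed

lemma triple_cancel:
  assumes "(3::'k) \<noteq> 0" "u + u + u = v + v + (v::'a)"
  shows "u = v"
proof -
  have "3 *s u = 3 *s v"
    using assms(2) scale_left_distrib[of 2 1 u] scale_left_distrib[of 2 1 v]
      scale_left_distrib[of 1 1 u] scale_left_distrib[of 1 1 v] by simp
  with assms(1) show ?thesis by simp
qed

end

context structurable_algebra
begin

lemma V_psi: "V a b (\<psi> x y \<cdot> z) + \<psi> x y \<cdot> V b a z = (\<psi> (V a b x) y + \<psi> x (V a b y)) \<cdot> z"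
proof -
  have 1: "V a b (V x z y) = V x z (V a b y) + V (V a b x) z y - V x (V b a z) y"
    using structurable[of a b x z y] by (simp add: algebra_simps)
  have 2: "V a b (V y z x) = V y z (V a b x) + V (V a b y) z x - V y (V b a z) x"
    using structurable[of a b y z x] by (simp add: algebra_simps)
  have 3: "V a b (\<psi> x y \<cdot> z) = V a b (V x z y) - V a b (V y z x)"
    unfolding V_swap[symmetric] by (simp add: V_def mult_add_left mult_add_right mult_diff)
  have 4: "\<psi> x y \<cdot> V b a z = V x (V b a z) y - V y (V b a z) x"
    "\<psi> (V a b x) y \<cdot> z = V (V a b x) z y - V y z (V a b x)"
    "\<psi> x (V a b y) \<cdot> z = V x z (V a b y) - V (V a b y) z x"
    by (simp_all add: V_swap)
  show ?thesis
    by (simp only: mult_add_left 1 2 3 4) (simp add: algebra_simps)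
qed

context
  assumes two: "(2::'k) \<noteq> 0" and three: "(3::'k) \<noteq> 0"
begin

lemma V_skew:
  assumes "s \<in> Skew"
  shows "V a b (s \<cdot> z) + s \<cdot> V b a z = (V a b s + s \<cdot> V b a \<one>) \<cdot> z"
proof -
  have p: "\<psi> s \<one> = s + s" using assms by (simp add: Skew_def \<psi>_def mult_one one_mult)
  have add: "V a b (x + y) = V a b x + V a b y" for x y
    by (simp add: V_def mult_add_left mult_add_right algebra_simps)
  define W where "W = \<psi> (V a b s) \<one> + \<psi> s (V a b \<one>)"
  have *: "V a b ((s + s) \<cdot> z) + (s + s) \<cdot> V b a z = W \<cdot> z" for z
    using V_psi[of a b s \<one> z] by (simp add: p W_def)
  from *[of \<one>] have "W = V a b s + s \<cdot> V b a \<one> + (V a b s + s \<cdot> V b a \<one>)"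
    by (simp add: mult_one add mult_add_left algebra_simps)
  note ** = *[of z, unfolded this]
  show ?thesis
    by (rule double_cancel[OF two]) (use ** in \<open>simp add: add mult_add_left algebra_simps\<close>)
qed

lemma assoc_skew:
  assumes "s \<in> Skew"
  shows "assoc a s z + assoc s (cnj a) z - assoc s z a + assoc s z (cnj a) = 0"
  using V_skew[OF assms, of a \<one> z] assms
  by (simp add: Skew_def alg_simps assoc_def algebra_simps)

lemma assoc_herm_skew:
  assumes "h \<in> Herm" "s \<in> Skew"
  shows "assoc h s z = - assoc s h z"
  using assoc_skew[OF assms(2), of h z] assms(1)
  by (simp add: Herm_def eq_neg_iff_add_eq_0)

lemma assoc_skew_herm_right:
  assumes "h \<in> Herm" "s \<in> Skew" "t \<in> Skew"
  shows "assoc t s h = - assoc t h s"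
proof -
  have "cnj (assoc h s t) = cnj (- assoc s h t)"
    using assoc_herm_skew[OF assms(1,2)] by simp
  with assms have "- assoc t s h = assoc t h s"
    by (simp add: cnj_assoc Herm_def Skew_def assoc_add)
  then show ?thesis by (metis minus_minus)
qed

lemma assoc_skew_skew:
  assumes "s \<in> Skew" "t \<in> Skew"
  shows "assoc t s z - assoc s t z = assoc s z t + assoc s z t"
proof -
  have t: "cnj t = - t" using assms(2) by (simp add: Skew_def)
  have "assoc t s z - assoc s t z - (assoc s z t + assoc s z t) = 0"
    using assoc_skew[OF assms(1), of t z] unfolding t by (simp add: assoc_add algebra_simps)
  then show ?thesis by simp
qed

lemma skew_alternative:
  assumes s: "s \<in> Skew"
  shows "assoc s x y = - assoc x s y"
proof -
  have skew: "assoc s t y = - assoc t s y" if t: "t \<in> Skew" for t y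
  proof -
    have H: "assoc s t h = - assoc t s h" if "h \<in> Herm" for h
      using assoc_skew_skew[OF s t, of h] assoc_skew_herm_right[OF that t s]
      by (simp add: algebra_simps eq_neg_iff_add_eq_0)
    have S: "assoc s t u = - assoc t s u" if u: "u \<in> Skew" for u
    proof -
      have outer: "assoc s t u = - assoc u t s" if "s \<in> Skew" "t \<in> Skew" "u \<in> Skew" for s t u
      proof (rule double_cancel[OF two])
        have "assoc u s t - assoc s u t = assoc s t u + assoc s t u"
          by (rule assoc_skew_skew[OF that(1,3)])
        moreover have "assoc s u t - assoc u s t = assoc u t s + assoc u t s"
          by (rule assoc_skew_skew[OF that(3,1)])
        ultimately show "assoc s t u + assoc s t u = - assoc u t s + - assoc u t s"
          by (metis minus_add_distrib minus_diff_eq)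
      qed
      have 1: "assoc t s u - assoc s t u = assoc s u t + assoc s u t"
        by (rule assoc_skew_skew[OF s t])
      have "assoc u t s - assoc t u s = assoc t s u + assoc t s u"
        by (rule assoc_skew_skew[OF t u])
      then have "- assoc s t u - - assoc s u t = assoc t s u + assoc t s u"
        by (simp only: outer[OF s t u] outer[OF s u t] minus_minus)
      then have 2: "assoc s u t = assoc t s u + assoc t s u + assoc s t u"
        by (simp add: diff_eq_eq)
      show ?thesis
      proof (rule triple_cancel[OF three])
        let ?p = "assoc s t u" and ?q = "assoc t s u"
        have "?q - ?p = (?q + ?q + ?p) + (?q + ?q + ?p)" using 1 by (simp only: 2)
        then have "(?q + ?q + ?p) + (?q + ?q + ?p) - (?q - ?p) = 0" by simp
        then have "?p + ?p + ?p + (?q + ?q + ?q) = 0" by (simp add: algebra_simps)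
        then show "?p + ?p + ?p = - ?q + - ?q + - ?q" by (simp add: eq_neg_iff_add_eq_0 algebra_simps)
      qed
    qed
    have "y + y = (y + cnj y) + (y - cnj y)" by simp
    moreover have "y + cnj y \<in> Herm" "y - cnj y \<in> Skew"
      by (simp_all add: Herm_def Skew_def cnj_add cnj_diff cnj_cnj add.commute)
    ultimately have *: "assoc s t (y + y) = - assoc t s (y + y)"
      by (metis H S assoc_add(3) minus_add_distrib)
    show ?thesis
      by (rule double_cancel[OF two]) (use * in \<open>simp add: assoc_add\<close>)
  qed
  have "x + cnj x \<in> Herm" "x - cnj x \<in> Skew"
    by (simp_all add: Herm_def Skew_def cnj_add cnj_diff cnj_cnj add.commute)
  moreover have "assoc s h y = - assoc h s y" if "h \<in> Herm" for h
    using assoc_herm_skew[OF that s, of y] by simp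
  ultimately have
    "assoc s (x + cnj x) y + assoc s (x - cnj x) y
      = - assoc (x + cnj x) s y + - assoc (x - cnj x) s y"
    using skew by simp
  then have *: "assoc s (x + x) y = - assoc (x + x) s y"
    by (simp add: assoc_add)
  show ?thesis
    by (rule double_cancel[OF two]) (use * in \<open>simp add: assoc_add\<close>)
qed

lemma skew_alternative_right:
  assumes s: "s \<in> Skew"
  shows "assoc x y s = - assoc x s y"
proof -
  have "cnj (assoc s (cnj y) (cnj x)) = cnj (- assoc (cnj y) s (cnj x))"
    using skew_alternative[OF s] by simp
  with s show ?thesis
    by (simp add: cnj_assoc cnj_cnj Skew_def assoc_add)
qed

lemma assoc_rotate:
  assumes s: "s \<in> Skew"
  shows "assoc x y s = assoc s x y"
  using skew_alternative_right[OF s, of x y] skew_alternative[OF s, of x y] by simp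

lemma V_plus2:
  assumes s: "s \<in> Skew"
  shows "V a b s + s \<cdot> cnj (V a b \<one>) = - \<psi> a (s \<cdot> b)"
proof -
  define Q where "Q x y = assoc s x y + assoc s y x" for x y
  have Q: "Q x y = Q (cnj x) y" for x y
  proof -
    have x: "assoc x s y = - assoc s x y" using skew_alternative[OF s, of x y] by simp
    have "Q (cnj x) y - Q x y = 0"
      using assoc_skew[OF s, of x y] unfolding x by (simp add: Q_def algebra_simps)
    then show ?thesis by simp
  qed
  have comm: "Q x y = Q y x" for x y by (simp add: Q_def add.commute)
  have "V a b s + s \<cdot> cnj (V a b \<one>) + \<psi> a (s \<cdot> b) = Q a (cnj b) - Q (cnj a) b"
    using s unfolding Q_def assoc_rotate[OF s, symmetric, of a]
    by (simp add: Skew_def alg_simps assoc_def algebra_simps)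
  also have "Q a (cnj b) = Q (cnj a) b"
    by (metis Q comm)
  finally show ?thesis by (simp add: eq_neg_iff_add_eq_0)
qed

lemma act_plus2_V:
  assumes s: "s \<in> Skew"
  shows "act_plus2 (V a b) s = - \<psi> a (s \<cdot> b)"
  unfolding act_plus2_def
  by (rule V_extension_eq[where f = "\<lambda>D. D s + s \<cdot> cnj (D \<one>)"], rule linear_fun_scaleI)
    (simp_all add: V_plus2[OF s] fun_scale_def mult_add_right cnj_add cnj_scale mult_scale_right
      scale_right_distrib algebra_simps)

lemma act_minus2_V:
  assumes t: "t \<in> Skew"
  shows "act_minus2 (V a b) t = \<psi> b (t \<cdot> a)"
proof -
  define E where "E D y = D y - (D \<one> + cnj (D \<one>)) \<cdot> y" for D y
  have E: "E (V a b) y = - V b a y" for a b y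
    by (simp add: E_def alg_simps)
  show ?thesis
    unfolding act_minus2_def
  proof (rule V_extension_eq[where f = "\<lambda>D. E D t + t \<cdot> cnj (E D \<one>)"], rule linear_fun_scaleI)
    show "E (V a b) t + t \<cdot> cnj (E (V a b) \<one>) = \<psi> b (t \<cdot> a)" for a b
    proof -
      have "E (V a b) t + t \<cdot> cnj (E (V a b) \<one>) = - (V b a t + t \<cdot> cnj (V b a \<one>))"
        by (simp add: E)
      then show ?thesis by (simp add: V_plus2[OF t])
    qed
  qed (simp_all add: E_def fun_scale_def mult_add_right mult_add_left mult_diff cnj_add cnj_diff cnj_cnj cnj_mult
      cnj_scale mult_scale_left mult_scale_right scale_right_distrib scale_right_diff_distrib)
qed

text \<open>In particular \<open>L\<^sub>s L\<^sub>t\<close> belongs to \<open>Instrl\<close>.\<close>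

lemma L_L_in_Instrl:
  assumes s: "s \<in> Skew" and t: "t \<in> Skew"
  shows "(\<lambda>z. s \<cdot> (t \<cdot> z)) \<in> Instrl"
proof -
  interpret funs: vector_space fun_scale by (rule fun_vector_space)
  have "V \<one> (t \<cdot> s) z - V s t z = s \<cdot> (t \<cdot> z) + s \<cdot> (t \<cdot> z)" for z
  proof -
    have "assoc z s t = assoc t z s" "assoc z t s = assoc s z t"
      "assoc t z s = assoc s t z" "assoc s z t = assoc t s z" "assoc t s z = - assoc s t z"
      by (rule assoc_rotate[OF t] assoc_rotate[OF s] skew_alternative[OF t])+
    then have "assoc z s t - assoc z t s = assoc s t z + assoc s t z" by simp
    moreover have "V \<one> (t \<cdot> s) z - V s t z
      = (s \<cdot> t) \<cdot> z + (s \<cdot> t) \<cdot> z - (assoc z s t - assoc z t s)"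
      using s t by (simp add: Skew_def alg_simps assoc_def algebra_simps)
    ultimately show ?thesis by (simp add: assoc_def)
  qed
  then have "fun_scale 2 (\<lambda>z. s \<cdot> (t \<cdot> z)) = V \<one> (t \<cdot> s) - V s t"
    using scale_left_distrib[of 1 1] by (simp add: fun_scale_def fun_eq_iff)
  moreover have "V \<one> (t \<cdot> s) - V s t \<in> Instrl"
    unfolding Instrl_def by (intro funs.span_diff funs.span_base) blast+
  ultimately have "fun_scale 2 (\<lambda>z. s \<cdot> (t \<cdot> z)) \<in> Instrl" by simp
  then have "fun_scale (1/2) (fun_scale 2 (\<lambda>z. s \<cdot> (t \<cdot> z))) \<in> Instrl"
    unfolding Instrl_def by (rule funs.span_scale)
  then show ?thesis using two by (simp add: fun_scale_def)
qed

end

end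

end

theory Submission
  imports Defs
begin

text \<open>
  Let \<open>x\<close> be an element of degree 1 and \<open>s\<close> one of degree 2 in a 5-graded Lie algebra over a field of
  characteristic different from 2 and 3. Since \<open>[x, s] = 0\<close>, the map \<open>e(x, s)\<close> is the product of the
  truncated exponentials of \<open>ad x\<close> and of \<open>ad s\<close>. The second one is always an automorphism, because
  \<open>(ad s)\<^sup>3 = 0\<close>. For \<open>E = exp (ad x)\<close>, write \<open>d\<^sub>n = (ad x)\<^sup>n / n!\<close> with \<open>n \<le> 4\<close>; the Leibniz rule gives
  \<open>[E a, E b] = E [a, b]\<close> up to the sums of all \<open>[d\<^sub>i a, d\<^sub>j b]\<close> with fixed \<open>i + j \<ge> 5\<close>. In characteristic 5
  these cannot be removed by dividing \<open>(ad x)\<^sup>5 = 0\<close> by \<open>5!\<close>. By degree they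
  vanish unless \<open>a\<close> and \<open>b\<close> have, in some order, degrees \<open>-2, -1\<close> or \<open>-2, -2\<close>. The second case follows
  from the first, because under the hypothesis on \<open>x\<close> used below every element of degree \<open>-2\<close> is a
  bracket of two elements of degree \<open>-1\<close>.

  The division hypothesis enters as follows. If \<open>V x y = id\<close>, then \<open>[x\<^sub>+, y\<^sub>-]\<close> acts on degree \<open>i\<close> as
  multiplication by \<open>i\<close>, so \<open>x\<^sub>+\<close> and \<open>y\<^sub>-\<close> behave like the standard generators of \<open>sl\<^sub>2\<close>. Let \<open>f = y\<^sub>-\<close>
  and let \<open>\<phi>(a, b)\<close> be the sum of the \<open>[d\<^sub>i a, d\<^sub>j b]\<close> with \<open>i + j = 5\<close>. For \<open>t\<close> of degree \<open>-2\<close> and \<open>w\<close> of degree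
  \<open>-1\<close> the commutation rules of \<open>ad f\<close> with the \<open>d\<^sub>n\<close> give \<open>[f, \<phi>(t, w)] = \<phi>(t, [f, w])\<close> and
  \<open>[f, [f, \<phi>(t, w)]] = 0\<close>. As \<open>(ad f)\<^sup>2\<close> is injective on the component of degree 2, \<open>\<phi>(t, w) = 0\<close>
  (lemma \<open>exp_defect_vanishes\<close>).

  It remains to know that \<open>K(A)\<close> is a Lie algebra. It is generated by its components of degree
  \<open>1\<close> and \<open>-1\<close>, so it suffices that \<open>ad x\<^sub>+\<close> and \<open>ad y\<^sub>-\<close> are derivations. For \<open>ad x\<^sub>+\<close> this amounts to a few
  identities of structurable algebras (lemma \<open>K_jacobi_plus1\<close>); the automorphism that reverses
  the grading transfers it to \<open>ad y\<^sub>-\<close>.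
\<close>

section \<open>Exponentials in 5-graded Lie algebras\<close>

text \<open>
  The Lie algebra is the carrier \<open>L\<close>, a subspace of the ambient type; the bracket is only
  controlled on \<open>L\<close>. In characteristic different from 2, antisymmetry is the same as \<open>[a, a] = 0\<close>.
\<close>

locale graded_lie_algebra_5 = vector_space sc
  for sc :: "'k::field \<Rightarrow> 'l::ab_group_add \<Rightarrow> 'l" (infixr "*s" 75) +
  fixes Lg :: "int \<Rightarrow> 'l set" and br :: "'l \<Rightarrow> 'l \<Rightarrow> 'l"
  assumes subspace_Lg: "subspace (Lg i)"
    and Lg_outside: "i < -2 \<or> 2 < i \<Longrightarrow> Lg i = {0}"
    and br_Lg: "a \<in> Lg i \<Longrightarrow> b \<in> Lg j \<Longrightarrow> br a b \<in> Lg (i + j)"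
    and br_add_left: "a \<in> graded_carrier Lg \<Longrightarrow> b \<in> graded_carrier Lg \<Longrightarrow> c \<in> graded_carrier Lg
      \<Longrightarrow> br (a + b) c = br a c + br b c"
    and br_scale_left: "a \<in> graded_carrier Lg \<Longrightarrow> b \<in> graded_carrier Lg \<Longrightarrow> br (r *s a) b = r *s br a b"
    and br_antisym: "a \<in> graded_carrier Lg \<Longrightarrow> b \<in> graded_carrier Lg \<Longrightarrow> br a b = - br b a"
    and jacobi: "a \<in> graded_carrier Lg \<Longrightarrow> b \<in> graded_carrier Lg \<Longrightarrow> c \<in> graded_carrier Lg
      \<Longrightarrow> br a (br b c) = br (br a b) c + br b (br a c)"
    and two: "(2::'k) \<noteq> 0" and three: "(3::'k) \<noteq> 0"
begin

abbreviation L :: "'l set" where "L \<equiv> graded_carrier Lg"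

subsection \<open>Homogeneous components\<close>

lemmas Lg_add = subspace_add[OF subspace_Lg]
lemmas Lg_scale = subspace_scale[OF subspace_Lg]
lemmas Lg_zero = subspace_0[OF subspace_Lg]

lemma L_add [simp]:
  assumes "a \<in> L" "b \<in> L" shows "a + b \<in> L"
proof -
  obtain f g where "\<forall>i\<in>{-2..2}. f i \<in> Lg i" "\<forall>i\<in>{-2..2}. g i \<in> Lg i"
    "a = (\<Sum>i=-2..2. f i)" "b = (\<Sum>i=-2..2. g i)"
    using assms by (auto simp: graded_carrier_def)
  then show ?thesis
    unfolding graded_carrier_def mem_Collect_eq
    by (intro exI[of _ "\<lambda>i. f i + g i"]) (simp add: sum.distrib Lg_add)
qed

lemma L_scale [simp]:
  assumes "a \<in> L" shows "r *s a \<in> L"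
proof -
  obtain f where "\<forall>i\<in>{-2..2}. f i \<in> Lg i" "a = (\<Sum>i=-2..2. f i)"
    using assms by (auto simp: graded_carrier_def)
  then show ?thesis
    unfolding graded_carrier_def mem_Collect_eq
    by (intro exI[of _ "\<lambda>i. r *s f i"]) (simp add: scale_sum_right Lg_scale)
qed

lemma Lg_subset:
  assumes "a \<in> Lg i" shows "a \<in> L"
proof -
  have "a = 0" if "i \<notin> {-2..2}" using assms Lg_outside[of i] that by auto
  then have "a = (\<Sum>j=-2..2. if j = i then a else 0)" by (auto simp: sum.delta)
  then show ?thesis
    unfolding graded_carrier_def mem_Collect_eq
    by (intro exI[of _ "\<lambda>j. if j = i then a else 0"]) (use assms Lg_zero in auto)
qed

lemma L_zero [simp]: "0 \<in> L"
  using Lg_subset Lg_zero by blast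

lemma L_minus [simp]: "a \<in> L \<Longrightarrow> - a \<in> L"
  using L_scale[of a "-1"] by simp

lemma L_induct [consumes 1, case_names homogeneous add]:
  assumes "z \<in> L" "\<And>i a. a \<in> Lg i \<Longrightarrow> P a"
    "\<And>a b. a \<in> L \<Longrightarrow> b \<in> L \<Longrightarrow> P a \<Longrightarrow> P b \<Longrightarrow> P (a + b)"
  shows "P z"
proof -
  obtain f where f: "\<forall>i\<in>{-2..2}. f i \<in> Lg i" "z = (\<Sum>i=-2..2. f i)"
    using assms(1) by (auto simp: graded_carrier_def)
  have "sum f A \<in> L \<and> P (sum f A)" if "A \<subseteq> {-2..2}" for A
    using finite_subset[OF that finite_atLeastAtMost_int] that
  proof (induction A rule: finite_induct)
    case empty
    show ?case using assms(2)[OF Lg_zero] by simp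
  next
    case (insert i A)
    then show ?case by (auto intro!: assms(3) L_add intro: assms(2)[of _ i] Lg_subset[of _ i] simp: f(1)[rule_format, of i])
  qed
  then show ?thesis using f(2) by blast
qed

lemma br_add_right:
  assumes "a \<in> L" "b \<in> L" "c \<in> L"
  shows "br c (a + b) = br c a + br c b"
  using assms br_antisym[of c "a + b"] br_antisym[of c a] br_antisym[of c b] br_add_left[of a b c] by simp

lemma L_br [simp]:
  assumes "a \<in> L" "b \<in> L" shows "br a b \<in> L"
  using assms(1)
proof (induction rule: L_induct)
  case (homogeneous i a)
  show ?case using assms(2)
  proof (induction rule: L_induct)
    case (homogeneous j b)
    then show ?case using br_Lg[OF \<open>a \<in> Lg i\<close>] Lg_subset by blast
  next
    case (add b c)
    then show ?case using br_add_right[of b c a] Lg_subset[OF \<open>a \<in> Lg i\<close>] by simp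
  qed
next
  case (add a c)
  then show ?case using assms(2) by (simp add: br_add_left)
qed

lemma br_add [simp]:
  assumes "a \<in> L" "b \<in> L" "c \<in> L"
  shows "br (a + b) c = br a c + br b c" "br c (a + b) = br c a + br c b"
  using assms br_add_left br_add_right by auto

lemma br_scale [simp]:
  assumes "a \<in> L" "b \<in> L"
  shows "br (r *s a) b = r *s br a b" "br a (r *s b) = r *s br a b"
  using assms br_scale_left[of a b] br_scale_left[of b a] br_antisym[of a "r *s b"] br_antisym[of a b] by simp_all

lemma br_minus [simp]:
  assumes "a \<in> L" "b \<in> L"
  shows "br (- a) b = - br a b" "br a (- b) = - br a b"
  using br_scale[OF assms, of "-1"] by simp_all

lemma br_zero [simp]:
  assumes "a \<in> L" shows "br 0 a = 0" "br a 0 = 0"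
  using br_scale[OF assms assms, of 0] by simp_all

text \<open>Small multiples are written as sums, so that vector identities reduce to rewriting in an abelian group.\<close>

lemma multiples: "2 *s v = v + v" "3 *s v = v + v + v" "4 *s v = v + v + v + v"
proof -
  show 2: "2 *s v = v + v" for v using scale_left_distrib[of 1 1 v] by simp
  show 3: "3 *s v = v + v + v" using scale_left_distrib[of 2 1 v] by (simp add: 2)
  show "4 *s v = v + v + v + v" using scale_left_distrib[of 3 1 v] by (simp add: 2 3 scale_left_distrib[of 2 1 v, simplified])
qed

lemma cancel_multiple:
  assumes "c \<in> {1,2,3,4::'k}" "c *s u = c *s v" shows "u = v"
proof -
  have "(4::'k) = 2 * 2" by simp
  then have "(4::'k) \<noteq> 0" using two by (metis mult_eq_0_iff)
  then have "c \<noteq> 0" using assms(1) two three by auto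
  then show ?thesis using assms(2) by simp
qed

subsection \<open>Divided powers\<close>

text \<open>
  The divided powers \<open>d\<^sub>n = (ad x)\<^sup>n / n!\<close>. They are used for \<open>n \<le> 4\<close> only, where \<open>n!\<close> is invertible.
\<close>

definition dp :: "'l \<Rightarrow> nat \<Rightarrow> 'l \<Rightarrow> 'l" where
  "dp x n w = (1 / of_nat (fact n)) *s ((br x ^^ n) w)"

lemma exp_ad_dp: "exp_ad sc br x w = w + dp x 1 w + dp x 2 w + dp x 3 w + dp x 4 w"
proof -
  have "{..4::nat} = {0,1,2,3,4}" by auto
  then show ?thesis by (simp add: exp_ad_def dp_def add.assoc)
qed

lemma pow_br_L [simp]: "x \<in> L \<Longrightarrow> w \<in> L \<Longrightarrow> (br x ^^ n) w \<in> L"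
  by (induction n) auto

lemma dp_L [simp]: "x \<in> L \<Longrightarrow> w \<in> L \<Longrightarrow> dp x n w \<in> L"
  by (simp add: dp_def)

lemma pow_br_add: "x \<in> L \<Longrightarrow> u \<in> L \<Longrightarrow> v \<in> L \<Longrightarrow> (br x ^^ n) (u + v) = (br x ^^ n) u + (br x ^^ n) v"
  by (induction n) auto

lemma pow_br_scale: "x \<in> L \<Longrightarrow> u \<in> L \<Longrightarrow> (br x ^^ n) (r *s u) = r *s (br x ^^ n) u"
  by (induction n) auto

lemma dp_add [simp]: "x \<in> L \<Longrightarrow> u \<in> L \<Longrightarrow> v \<in> L \<Longrightarrow> dp x n (u + v) = dp x n u + dp x n v"
  by (simp add: dp_def pow_br_add scale_right_distrib)

lemma dp_scale [simp]: "x \<in> L \<Longrightarrow> u \<in> L \<Longrightarrow> dp x n (r *s u) = r *s dp x n u"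
  by (simp add: dp_def pow_br_scale mult.commute)

lemma dp_minus [simp]: "x \<in> L \<Longrightarrow> u \<in> L \<Longrightarrow> dp x n (- u) = - dp x n u"
  using dp_scale[of x u n "-1"] by simp

lemma dp_diff [simp]: "x \<in> L \<Longrightarrow> u \<in> L \<Longrightarrow> v \<in> L \<Longrightarrow> dp x n (u - v) = dp x n u - dp x n v"
  using dp_add[of x u "- v" n] by simp

lemma dp_zero [simp]: "x \<in> L \<Longrightarrow> dp x n 0 = 0"
  using dp_scale[of x 0 n 0] by simp

lemma dp_1: "dp x 1 w = br x w" "dp x (Suc 0) w = br x w"
  by (simp_all add: dp_def)

lemma br_dp:
  assumes "x \<in> L" "w \<in> L"
  shows "br x w = dp x 1 w" "br x (dp x 1 w) = 2 *s dp x 2 w" "br x (dp x 2 w) = 3 *s dp x 3 w"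
    "br x (dp x 3 w) = 4 *s dp x 4 w"
proof -
  have 4: "(4::'k) \<noteq> 0" using two by (metis mult_2 mult_eq_0_iff numeral_Bit0 one_add_one)
  have *: "br x (dp x n w) = (of_nat (Suc n)) *s dp x (Suc n) w" if "of_nat (Suc n) \<noteq> (0::'k)" for n
    using assms that by (simp add: dp_def del: of_nat_Suc mult_Suc)
  show "br x w = dp x 1 w" by (simp add: dp_def)
  show "br x (dp x 1 w) = 2 *s dp x 2 w" using *[of 1] two by (simp add: numeral_2_eq_2[symmetric])
  show "br x (dp x 2 w) = 3 *s dp x 3 w" using *[of 2] three by (simp add: numeral_3_eq_3[symmetric])
  show "br x (dp x 3 w) = 4 *s dp x 4 w" using *[of 3] 4 by simp
qed

lemma dp_Lg: "x \<in> Lg i \<Longrightarrow> w \<in> Lg j \<Longrightarrow> dp x n w \<in> Lg (j + int n * i)"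
proof -
  assume *: "x \<in> Lg i" "w \<in> Lg j"
  have "(br x ^^ n) w \<in> Lg (j + int n * i)"
  proof (induction n)
    case 0
    then show ?case using * by simp
  next
    case (Suc n)
    then show ?case using br_Lg[OF *(1) Suc] by (simp add: algebra_simps)
  qed
  then show ?thesis by (simp add: dp_def Lg_scale)
qed

lemma dp_leibniz:
  assumes "x \<in> L" "a \<in> L" "b \<in> L"
  shows "dp x 1 (br a b) = br (dp x 1 a) b + br a (dp x 1 b)"
    "dp x 2 (br a b) = br (dp x 2 a) b + br (dp x 1 a) (dp x 1 b) + br a (dp x 2 b)"
    "dp x 3 (br a b) = br (dp x 3 a) b + br (dp x 2 a) (dp x 1 b) + br (dp x 1 a) (dp x 2 b) + br a (dp x 3 b)"
    "dp x 4 (br a b) = br (dp x 4 a) b + br (dp x 3 a) (dp x 1 b) + br (dp x 2 a) (dp x 2 b)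
      + br (dp x 1 a) (dp x 3 b) + br a (dp x 4 b)"
proof -
  note [simp del] = One_nat_def
  note D = jacobi[OF assms(1)]
  note s = assms br_dp(2-4)[OF assms(1)] br_dp(1)[OF assms(1), of a] br_dp(1)[OF assms(1), of b] D multiples
  show 1: "dp x 1 (br a b) = br (dp x 1 a) b + br a (dp x 1 b)"
    using D[OF assms(2,3)] assms by (simp add: dp_1)
  have "2 *s dp x 2 (br a b) = br x (dp x 1 (br a b))" using assms by (simp add: br_dp(2))
  also have "\<dots> = 2 *s (br (dp x 2 a) b + br (dp x 1 a) (dp x 1 b) + br a (dp x 2 b))"
    unfolding 1 by (simp add: s)
  finally show 2: "dp x 2 (br a b) = br (dp x 2 a) b + br (dp x 1 a) (dp x 1 b) + br a (dp x 2 b)"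
    by (rule cancel_multiple[of 2, rotated]) simp_all
  have "3 *s dp x 3 (br a b) = br x (dp x 2 (br a b))" using assms by (simp add: br_dp(3))
  also have "\<dots> = 3 *s (br (dp x 3 a) b + br (dp x 2 a) (dp x 1 b) + br (dp x 1 a) (dp x 2 b) + br a (dp x 3 b))"
    unfolding 2 by (simp add: s)
  finally show 3: "dp x 3 (br a b) = br (dp x 3 a) b + br (dp x 2 a) (dp x 1 b) + br (dp x 1 a) (dp x 2 b) + br a (dp x 3 b)"
    by (rule cancel_multiple[of 3, rotated]) simp_all
  have "4 *s dp x 4 (br a b) = br x (dp x 3 (br a b))" using assms by (simp add: br_dp(4))
  also have "\<dots> = 4 *s (br (dp x 4 a) b + br (dp x 3 a) (dp x 1 b) + br (dp x 2 a) (dp x 2 b)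
      + br (dp x 1 a) (dp x 3 b) + br a (dp x 4 b))"
    unfolding 3 by (simp add: s)
  finally show "dp x 4 (br a b) = br (dp x 4 a) b + br (dp x 3 a) (dp x 1 b) + br (dp x 2 a) (dp x 2 b)
      + br (dp x 1 a) (dp x 3 b) + br a (dp x 4 b)"
    by (rule cancel_multiple[of 4, rotated]) simp_all
qed


lemma br_sum_5:
  assumes "a0 \<in> L" "a1 \<in> L" "a2 \<in> L" "a3 \<in> L" "a4 \<in> L"
    and "b0 \<in> L" "b1 \<in> L" "b2 \<in> L" "b3 \<in> L" "b4 \<in> L"
  shows "br (a0 + a1 + a2 + a3 + a4) (b0 + b1 + b2 + b3 + b4) =
    br a0 b0 + (br a1 b0 + br a0 b1) + (br a2 b0 + br a1 b1 + br a0 b2)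
    + (br a3 b0 + br a2 b1 + br a1 b2 + br a0 b3) + (br a4 b0 + br a3 b1 + br a2 b2 + br a1 b3 + br a0 b4)
    + (br a1 b4 + br a2 b3 + br a3 b2 + br a4 b1) + (br a2 b4 + br a3 b3 + br a4 b2)
    + (br a3 b4 + br a4 b3) + br a4 b4"
proof -
  let ?b = "b0 + b1 + b2 + b3 + b4"
  have b: "?b \<in> L" and r: "br a ?b = br a b0 + br a b1 + br a b2 + br a b3 + br a b4" if "a \<in> L" for a
    using assms that by simp_all
  have "br (a0 + a1 + a2 + a3 + a4) ?b = br a0 ?b + br a1 ?b + br a2 ?b + br a3 ?b + br a4 ?b"
    using assms b[OF assms(1)] by (simp only: br_add(1) L_add)
  then show ?thesis unfolding r[OF assms(1)] r[OF assms(2)] r[OF assms(3)] r[OF assms(4)] r[OF assms(5)]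
    by (simp only: add.assoc add.left_commute add.commute)
qed

text \<open>
  The exponential of \<open>ad x\<close> respects the bracket of \<open>a\<close> and \<open>b\<close> up to the terms of order 5 to 8.
\<close>

lemma exp_br_expand:
  assumes "x \<in> L" "a \<in> L" "b \<in> L"
  shows "br (exp_ad sc br x a) (exp_ad sc br x b) = exp_ad sc br x (br a b)
    + (br (dp x 1 a) (dp x 4 b) + br (dp x 2 a) (dp x 3 b) + br (dp x 3 a) (dp x 2 b) + br (dp x 4 a) (dp x 1 b))
    + (br (dp x 2 a) (dp x 4 b) + br (dp x 3 a) (dp x 3 b) + br (dp x 4 a) (dp x 2 b))
    + (br (dp x 3 a) (dp x 4 b) + br (dp x 4 a) (dp x 3 b)) + br (dp x 4 a) (dp x 4 b)"
  unfolding exp_ad_dp dp_leibniz[OF assms] by (rule br_sum_5) (use assms in simp_all)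

lemma exp_L [simp]: "x \<in> L \<Longrightarrow> w \<in> L \<Longrightarrow> exp_ad sc br x w \<in> L"
  by (simp add: exp_ad_dp del: One_nat_def)

lemma exp_add: "x \<in> L \<Longrightarrow> u \<in> L \<Longrightarrow> v \<in> L \<Longrightarrow>
    exp_ad sc br x (u + v) = exp_ad sc br x u + exp_ad sc br x v"
  by (simp add: exp_ad_dp algebra_simps del: One_nat_def)

lemma exp_scale: "x \<in> L \<Longrightarrow> u \<in> L \<Longrightarrow> exp_ad sc br x (r *s u) = r *s exp_ad sc br x u"
  by (simp add: exp_ad_dp scale_right_distrib del: One_nat_def)

text \<open>An operator on \<open>L\<close> that raises degrees by more than 4 is zero.\<close>

lemma nilpotent_Lg:
  assumes "x \<in> Lg i" "i > 0" "w \<in> L"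
  shows "(br x ^^ 5) w = 0" "i = 2 \<Longrightarrow> dp x 3 w = 0"
proof -
  have x: "x \<in> L" using assms Lg_subset by blast
  have vanish: "dp x n w = 0" if n: "int n * i > 4" for n
    using assms(3)
  proof (induction rule: L_induct)
    case (homogeneous j a)
    show ?case
    proof (cases "j < -2")
      case True
      then have "a = 0" using homogeneous Lg_outside by blast
      then show ?thesis using x by simp
    next
      case False
      then show ?thesis using dp_Lg[OF assms(1) homogeneous, of n] Lg_outside[of "j + int n * i"] n by auto
    qed
  next
    case (add a b)
    then show ?case using x by simp
  qed
  show "dp x 3 w = 0" if "i = 2" using vanish[of 3] that by simp
  show "(br x ^^ 5) w = 0"
  proof -
    have "int 4 * i > 4 \<or> i = 1" using assms(2) by auto
    then have *: "br x (dp x 4 w) = 0"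
    proof
      assume "int 4 * i > 4"
      then show ?thesis using vanish[of 4] x by simp
    next
      assume i: "i = 1"
      show ?thesis using assms(3)
      proof (induction rule: L_induct)
        case (homogeneous j a)
        have "br x (dp x 4 a) \<in> Lg (j + 5)" using br_Lg[OF assms(1) dp_Lg[OF assms(1) homogeneous, of 4]] i
          by (simp add: add.commute)
        moreover have "j < -2 \<Longrightarrow> a = 0" using homogeneous Lg_outside by blast
        ultimately show ?case using x Lg_outside[of "j + 5"] by (cases "j < -2") auto
      next
        case (add a b)
        then show ?case using x by simp
      qed
    qed
    have "dp x 4 w = (1 / 24) *s (br x ^^ 4) w" by (simp add: dp_def fact_numeral)
    moreover have "(24::'k) \<noteq> 0"
    proof -
      have "(24::'k) = 2 * 2 * 2 * 3" by simp
      then show ?thesis using two three by (metis mult_eq_0_iff)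
    qed
    ultimately have "(br x ^^ 4) w = 24 *s dp x 4 w" by simp
    then have "br x ((br x ^^ 4) w) = 0" using * x assms(3) by simp
    then show ?thesis by (simp add: eval_nat_numeral)
  qed
qed

lemma exp_inverse:
  assumes "x \<in> L" "w \<in> L" "(br x ^^ 5) w = 0"
  shows "exp_ad sc br (- x) (exp_ad sc br x w) = w"
proof -
  note [simp del] = One_nat_def
  have "(br (-x) ^^ n) u = (-1) ^ n *s (br x ^^ n) u" if "u \<in> L" for n u
    using assms(1) that by (induction n) simp_all
  then have neg: "dp (-x) n u = (-1) ^ n *s dp x n u" if "u \<in> L" for n u
    using that by (simp add: dp_def mult.commute)
  have pow: "(br x ^^ n) w = 0" if "n \<ge> 5" for n
    using that by (induction n rule: dec_induct) (use assms in auto)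
  have zero: "dp x m (dp x n w) = 0" if "m + n \<ge> 5" for m n
    using pow[OF that] assms by (simp add: dp_def pow_br_scale funpow_add)
  have b: "dp x 1 (dp x 1 w) = 2 *s dp x 2 w" "dp x 1 (dp x 2 w) = 3 *s dp x 3 w"
    "dp x 1 (dp x 3 w) = 4 *s dp x 4 w" "dp x 1 (dp x 4 w) = 0"
    using br_dp(2-4)[OF assms(1,2)] assms zero[of 1 4] by (simp_all add: dp_1)
  have half: "2 *s dp x 2 u = dp x 1 (dp x 1 u)" "3 *s dp x 3 u = dp x 1 (dp x 2 u)" if "u \<in> L" for u
    using br_dp(2,3)[OF assms(1) that] by (simp_all add: dp_1)
  have b21: "dp x 2 (dp x 1 w) = 3 *s dp x 3 w"
    by (rule cancel_multiple[of 2]) (use assms in \<open>simp_all add: half(1)[of "dp x 1 w"] b\<close>)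
  have b22: "dp x 2 (dp x 2 w) = 6 *s dp x 4 w"
    by (rule cancel_multiple[of 2]) (use assms in \<open>simp_all add: half(1)[of "dp x 2 w"] b\<close>)
  have b31: "dp x 3 (dp x 1 w) = 4 *s dp x 4 w"
    by (rule cancel_multiple[of 3]) (use assms in \<open>simp_all add: half(2)[of "dp x 1 w"] b b21\<close>)
  have 6: "6 *s v = v + v + v + v + v + v" for v
    using scale_left_distrib[of 3 3 v] by (simp add: multiples)
  then show ?thesis
    unfolding exp_ad_dp using assms(1,2)
    by (simp add: neg b b21 b22 b31 zero multiples 6 algebra_simps)
qed

text \<open>
  In \<open>exp(ad x) exp(ad s)\<close> and in \<open>exp(ad (x + s))\<close> all terms with \<open>i\<close> factors \<open>ad x\<close> and \<open>j\<close> factors \<open>ad s\<close>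
  with \<open>i + 2 j > 4\<close> vanish by degree, so both truncated sums keep the same terms.
\<close>

lemma exp_sum:
  assumes x: "x \<in> Lg 1" and s: "s \<in> Lg 2" and w: "w \<in> L"
  shows "exp_ad sc br (x + s) w = exp_ad sc br x (exp_ad sc br s w)"
proof -
  note [simp del] = One_nat_def
  have L [simp]: "x \<in> L" "s \<in> L" using x s Lg_subset by blast+
  have xs: "br x s = 0" using br_Lg[OF x s] Lg_outside[of 3] by simp
  have comm: "br s (br x u) = br x (br s u)" if "u \<in> L" for u
    using jacobi[of x s u] that xs by simp
  have comm_dp: "br s (dp x n u) = dp x n (br s u)" if "u \<in> L" for n u
  proof -
    have "br s ((br x ^^ n) u) = (br x ^^ n) (br s u)"
      using that by (induction n) (simp_all add: comm)
    then show ?thesis using that by (simp add: dp_def)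
  qed
  have vanish: "dp x m (dp s n u) = 0" if u: "u \<in> L" and mn: "m + 2 * n > 4" for m n u
    using u
  proof (induction rule: L_induct)
    case (homogeneous j a)
    have "dp x m (dp s n a) \<in> Lg (j + int n * 2 + int m)"
      using dp_Lg[OF x dp_Lg[OF s homogeneous, of n], of m] by (simp add: mult.commute)
    moreover have "j < -2 \<Longrightarrow> a = 0" using homogeneous Lg_outside by blast
    ultimately show ?case using Lg_outside[of "j + int n * 2 + int m"] mn by (cases "j < -2") auto
  qed simp
  have s3: "dp s 3 w = 0" "dp s 4 w = 0"
    using vanish[OF w, of 0 3] vanish[OF w, of 0 4] by (simp_all add: dp_def)
  note bx = br_dp(2-4)[OF L(1)] and bs = br_dp(2-4)[OF L(2)] 
  have 1: "dp (x + s) 1 w = dp x 1 w + dp s 1 w" using w by (simp add: dp_1)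
  have x1: "br x u = dp x 1 u" and s1: "br s u = dp s 1 u" for u by (simp_all add: dp_1)
  have c: "dp s 1 (dp x n u) = dp x n (dp s 1 u)" if "u \<in> L" for n u
    using comm_dp[OF that] by (simp add: dp_1)
  have xx: "dp x 1 (dp x 1 u) = 2 *s dp x 2 u" "dp x 1 (dp x 2 u) = 3 *s dp x 3 u"
    "dp x 1 (dp x 3 u) = 4 *s dp x 4 u" if "u \<in> L" for u using bx[OF that] by (simp_all add: x1)
  have ss: "dp s 1 (dp s 1 u) = 2 *s dp s 2 u" "dp s 1 (dp s 2 u) = 3 *s dp s 3 u"
    if "u \<in> L" for u using bs[OF that] by (simp_all add: s1)
  note rules = w x1 s1 c xx ss s3 multiples vanish
  have 2: "dp (x + s) 2 w = dp x 2 w + dp x 1 (dp s 1 w) + dp s 2 w"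
  proof (rule cancel_multiple[of 2])
    have "2 *s dp (x + s) 2 w = br (x + s) (dp (x + s) 1 w)" using w by (subst br_dp(2)) simp_all
    also have "\<dots> = 2 *s (dp x 2 w + dp x 1 (dp s 1 w) + dp s 2 w)"
      unfolding 1 by (simp add: rules algebra_simps)
    finally show "2 *s dp (x + s) 2 w = 2 *s (dp x 2 w + dp x 1 (dp s 1 w) + dp s 2 w)" .
  qed simp
  have 3: "dp (x + s) 3 w = dp x 3 w + dp x 2 (dp s 1 w)"
  proof (rule cancel_multiple[of 3])
    have "3 *s dp (x + s) 3 w = br (x + s) (dp (x + s) 2 w)" using w by (subst br_dp(3)) simp_all
    also have "\<dots> = 3 *s (dp x 3 w + dp x 2 (dp s 1 w))"
      unfolding 2 by (simp add: rules algebra_simps)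
    finally show "3 *s dp (x + s) 3 w = 3 *s (dp x 3 w + dp x 2 (dp s 1 w))" .
  qed simp
  have 4: "dp (x + s) 4 w = dp x 4 w"
  proof (rule cancel_multiple[of 4])
    have "4 *s dp (x + s) 4 w = br (x + s) (dp (x + s) 3 w)" using w by (subst br_dp(4)) simp_all
    also have "\<dots> = 4 *s dp x 4 w"
      unfolding 3 by (simp add: rules algebra_simps)
    finally show "4 *s dp (x + s) 4 w = 4 *s dp x 4 w" .
  qed simp
  show ?thesis
    unfolding exp_ad_dp 1 2 3 4 by (simp add: rules algebra_simps)
qed

lemma lie_automorphism_exp:
  assumes x: "x \<in> Lg i" "i > 0"
    and hom: "\<And>a b. a \<in> L \<Longrightarrow> b \<in> L \<Longrightarrow> exp_ad sc br x (br a b) = br (exp_ad sc br x a) (exp_ad sc br x b)"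
  shows "lie_automorphism sc L br (exp_ad sc br x)"
proof -
  have L: "x \<in> L" "- x \<in> L" using Lg_subset[OF x(1)] by simp_all
  have "- x \<in> Lg i" using Lg_scale[OF x(1), of "-1"] by simp
  then have inv: "exp_ad sc br (-x) (exp_ad sc br x w) = w" "exp_ad sc br x (exp_ad sc br (-x) w) = w"
    if "w \<in> L" for w
    using exp_inverse[OF L(1) that] exp_inverse[OF L(2) that] nilpotent_Lg(1) x that by simp_all
  have "bij_betw (exp_ad sc br x) L L"
    by (rule bij_betw_byWitness[of _ "exp_ad sc br (-x)"]) (use inv L in auto)
  then show ?thesis
    unfolding lie_automorphism_def using L hom by (simp add: exp_add exp_scale)
qed

lemma exp_hom_bilinear:
  assumes "x \<in> L"
    and "\<And>i j a b. a \<in> Lg i \<Longrightarrow> b \<in> Lg j \<Longrightarrow> exp_ad sc br x (br a b) = br (exp_ad sc br x a) (exp_ad sc br x b)"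
    and "a \<in> L" "b \<in> L"
  shows "exp_ad sc br x (br a b) = br (exp_ad sc br x a) (exp_ad sc br x b)"
  using assms(3)
proof (induction rule: L_induct)
  case (homogeneous i a)
  then have a: "a \<in> L" by (rule Lg_subset)
  show ?case using assms(4)
  proof (induction rule: L_induct)
    case (homogeneous j b)
    then show ?case using assms(2) \<open>a \<in> Lg i\<close> by blast
  qed (use a assms(1) in \<open>simp add: exp_add\<close>)
qed (use assms(1,4) in \<open>simp add: exp_add\<close>)

lemma lie_automorphism_exp_degree_2:
  assumes s: "s \<in> Lg 2"
  shows "lie_automorphism sc L br (exp_ad sc br s)"
proof (rule lie_automorphism_exp[OF s])
  have L: "s \<in> L" using s Lg_subset by blast
  fix a b assume ab: "a \<in> L" "b \<in> L"
  have 3: "dp s 3 w = 0" if "w \<in> L" for w using nilpotent_Lg(2)[OF s _ that] by simp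
  have "dp s 4 w = 0" if "w \<in> L" for w
  proof (rule cancel_multiple[of 4])
    show "4 *s dp s 4 w = 4 *s 0" using br_dp(4)[OF L that] 3[OF that] L by simp
  qed simp
  with 3 show "exp_ad sc br s (br a b) = br (exp_ad sc br s a) (exp_ad sc br s b)"
    using exp_br_expand[OF L ab] L ab by simp
qed simp

lemma lie_automorphism_compose:
  assumes "lie_automorphism sc L br f" "lie_automorphism sc L br g" "\<And>w. w \<in> L \<Longrightarrow> h w = f (g w)"
  shows "lie_automorphism sc L br h"
proof -
  have g: "g w \<in> L" if "w \<in> L" for w
    using assms(2) that by (auto simp: lie_automorphism_def bij_betw_def)
  have "bij_betw (f \<circ> g) L L"
    using assms(1,2) by (auto simp: lie_automorphism_def intro: bij_betw_trans)
  then have "bij_betw h L L" using assms(3) by (simp cong: bij_betw_cong)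
  then show ?thesis
    using assms g unfolding lie_automorphism_def by simp
qed

subsection \<open>Exponentials of elements of degree one\<close>

context
  fixes e f
  assumes e: "e \<in> Lg 1" and f: "f \<in> Lg (-1)"
    and grading: "\<And>i z. z \<in> Lg i \<Longrightarrow> br (br e f) z = of_int i *s z"
begin

lemma e_f_L [simp]: "e \<in> L" "f \<in> L"
  using e f Lg_subset by blast+

text \<open>
  The pair \<open>e\<close>, \<open>f\<close> generates a copy of \<open>sl\<^sub>2\<close> (the standard triple is \<open>e\<close>, \<open>2 f\<close>, \<open>2 [e, f]\<close>).
\<close>

lemma br_f_e:
  assumes "z \<in> Lg i" shows "br f (br e z) = br e (br f z) - of_int i *s z"
  using jacobi[of e f z] grading[OF assms] Lg_subset[OF assms] by (simp add: algebra_simps)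

text \<open>
  This is \<open>[f, d\<^sub>n z] = d\<^sub>n [f, z] - (i + (n - 1) / 2) d\<^sub>n\<^sub>-\<^sub>1 z\<close> for \<open>z\<close> of degree \<open>i\<close>, with the denominator cleared
  for even \<open>n\<close>.
\<close>

lemma br_f_dp:
  assumes z: "z \<in> Lg i"
  shows "br f (dp e 1 z) = dp e 1 (br f z) - of_int i *s z"
    "2 *s br f (dp e 2 z) = 2 *s dp e 2 (br f z) - of_int (2 * i + 1) *s dp e 1 z"
    "br f (dp e 3 z) = dp e 3 (br f z) - of_int (i + 1) *s dp e 2 z"
    "2 *s br f (dp e 4 z) = 2 *s dp e 4 (br f z) - of_int (2 * i + 3) *s dp e 3 z"
proof -
  note [simp del] = One_nat_def
  have L [simp]: "z \<in> L" using z Lg_subset by blast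
  have d: "dp e n z \<in> Lg (i + int n)" for n using dp_Lg[OF e z] by simp
  have diff: "br e (u - v) = br e u - br e v" if "u \<in> L" "v \<in> L" for u v
    using br_add(2)[of u "- v" e] that by simp
  have e1: "br e u = dp e 1 u" for u by (simp add: dp_1)
  have ee: "dp e 1 (dp e 1 u) = 2 *s dp e 2 u" "dp e 1 (dp e 2 u) = 3 *s dp e 3 u"
    "dp e 1 (dp e 3 u) = 4 *s dp e 4 u" if "u \<in> L" for u
    using br_dp(2-4)[OF e_f_L(1) that] by (simp_all add: e1)
  have shift: "br f (br e (dp e n z)) = br e (br f (dp e n z)) - of_int (i + int n) *s dp e n z" for n
    using br_f_e[OF d] .
  have smult: "(c * 2) *s v = c *s v + c *s v" "(c * 3) *s v = c *s v + c *s v + c *s v"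
    "(c * 4) *s v = c *s v + c *s v + c *s v + c *s v" for c v
    by (simp_all add: scale_scale[symmetric] multiples scale_right_distrib del: scale_scale)
  show 1: "br f (dp e 1 z) = dp e 1 (br f z) - of_int i *s z"
    using br_f_e[OF z] by (simp add: dp_1)
  have "2 *s br f (dp e 2 z) = br f (br e (dp e 1 z))" by (simp add: br_dp(2))
  also have "\<dots> = br e (br f (dp e 1 z)) - of_int (i + 1) *s dp e 1 z" using shift[of 1] by simp
  also have "\<dots> = 2 *s dp e 2 (br f z) - of_int (2 * i + 1) *s dp e 1 z"
    unfolding 1 by (simp add: diff e1 ee scale_left_distrib multiples smult algebra_simps)
  finally show 2: "2 *s br f (dp e 2 z) = 2 *s dp e 2 (br f z) - of_int (2 * i + 1) *s dp e 1 z" .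
  show 3: "br f (dp e 3 z) = dp e 3 (br f z) - of_int (i + 1) *s dp e 2 z"
  proof (rule cancel_multiple[of 3])
    have "2 *s (3 *s br f (dp e 3 z)) = 2 *s br f (br e (dp e 2 z))" by (simp add: br_dp(3))
    also have "\<dots> = br e (2 *s br f (dp e 2 z)) - 2 *s (of_int (i + 2) *s dp e 2 z)"
      unfolding shift[of 2] by (simp add: scale_right_diff_distrib)
    also have "\<dots> = 2 *s (3 *s (dp e 3 (br f z) - of_int (i + 1) *s dp e 2 z))"
      unfolding 2 by (simp add: diff e1 ee scale_left_distrib multiples smult algebra_simps)
    finally show "3 *s br f (dp e 3 z) = 3 *s (dp e 3 (br f z) - of_int (i + 1) *s dp e 2 z)"
      by (rule cancel_multiple[of 2, rotated]) simp
  qed simp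
  show "2 *s br f (dp e 4 z) = 2 *s dp e 4 (br f z) - of_int (2 * i + 3) *s dp e 3 z"
  proof (rule cancel_multiple[of 2])
    have "2 *s (2 *s br f (dp e 4 z)) = br f (br e (dp e 3 z))" by (simp add: br_dp(4))
    also have "\<dots> = br e (br f (dp e 3 z)) - of_int (i + 3) *s dp e 3 z"
      using shift[of 3] by simp
    also have "\<dots> = 2 *s (2 *s dp e 4 (br f z) - of_int (2 * i + 3) *s dp e 3 z)"
      unfolding 3 by (simp add: diff e1 ee scale_left_distrib multiples smult algebra_simps)
    finally show "2 *s (2 *s br f (dp e 4 z)) = 2 *s (2 *s dp e 4 (br f z) - of_int (2 * i + 3) *s dp e 3 z)" .
  qed simp
qed

text \<open>The terms of order 5 by which \<open>exp(ad e)\<close> may fail to respect the bracket.\<close>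

definition exp_defect :: "'l \<Rightarrow> 'l \<Rightarrow> 'l" where
  "exp_defect a b = br (dp e 1 a) (dp e 4 b) + br (dp e 2 a) (dp e 3 b) + br (dp e 3 a) (dp e 2 b) + br (dp e 4 a) (dp e 1 b)"

text \<open>
  Formally \<open>exp_defect\<close> is the value of the bracket on the fifth divided power of \<open>e\<close> applied to a tensor. This
  explains its commutation with \<open>ad f\<close>: the correction term is a multiple of \<open>d\<^sub>4 [t, y]\<close>, and \<open>[t, y] = 0\<close>
  by degree.
\<close>

lemma exp_defect_vanishes:
  assumes t: "t \<in> Lg (-2)" and y: "y \<in> Lg (-1)"
  shows "exp_defect t y = 0"
proof -
  note [simp del] = One_nat_def
  define u where "u = br f y"
  have u: "u \<in> Lg (-2)" using br_Lg[OF f y] by (simp add: u_def)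
  have L [simp]: "t \<in> L" "y \<in> L" "u \<in> L" using t y u Lg_subset by blast+
  have low: "br f t = 0" "br f u = 0" "br t y = 0" "br t u = 0"
    using br_Lg[OF f t] br_Lg[OF f u] br_Lg[OF t y] br_Lg[OF t u] Lg_outside by auto
  have y4: "dp e 4 y = 0" using dp_Lg[OF e y, of 4] Lg_outside[of 3] by simp
  have D: "br f (br a b) = br (br f a) b + br a (br f b)" if "a \<in> L" "b \<in> L" for a b
    using jacobi[OF e_f_L(2) that] .
  define h :: 'k where "h = 1/2"
  have half: "h *s v + h *s v = v" "h *s v + (h *s v + w) = v + w" for v w
    using two by (simp_all flip: scale_left_distrib add.assoc add: h_def)
  have halve: "v = h *s w" if "2 *s v = w" for v w
    using that two by (auto simp: h_def)
  have t_rules: "br f (dp e 1 t) = t + t" "br f (dp e 2 t) = h *s (dp e 1 t + dp e 1 t + dp e 1 t)"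
    "br f (dp e 3 t) = dp e 2 t" "br f (dp e 4 t) = h *s dp e 3 t"
    if "t \<in> Lg (-2)" "br f t = 0" for t
    using br_f_dp[OF that(1)] that(2) by (auto intro!: halve simp: multiples)
  have y_rules: "br f (dp e 1 y) = dp e 1 u + y" "br f (dp e 2 y) = dp e 2 u + h *s dp e 1 y"
    "br f (dp e 3 y) = dp e 3 u" "dp e 4 u = h *s dp e 3 y"
    using br_f_dp[OF y] y4 halve[of "br f (dp e 2 y) - dp e 2 u" "dp e 1 y"] halve[of "dp e 4 u" "dp e 3 y"]
    by (auto simp: u_def scale_right_diff_distrib diff_eq_eq add.commute)
  have "br f (exp_defect t y) = exp_defect t u + dp e 4 (br t y) + br t (dp e 4 y)"
    unfolding exp_defect_def dp_leibniz(4)[OF e_f_L(1) L(1,2)]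
    by (simp add: D t_rules[OF t low(1)] y_rules y4 scale_right_distrib) (simp add: add_ac half)
  then have 1: "br f (exp_defect t y) = exp_defect t u" by (simp add: low y4)
  have "br f (exp_defect t u) = 2 *s dp e 4 (br t u)"
    unfolding exp_defect_def dp_leibniz(4)[OF e_f_L(1) L(1,3)]
    by (simp add: D t_rules[OF t low(1)] t_rules[OF u low(2)] scale_right_distrib multiples) (simp add: add_ac half)
  then have 2: "br f (exp_defect t u) = 0" by (simp add: low)
  have "exp_defect t y \<in> Lg 2"
    unfolding exp_defect_def
    using br_Lg[OF dp_Lg[OF e t, of 1] dp_Lg[OF e y, of 4]] br_Lg[OF dp_Lg[OF e t, of 2] dp_Lg[OF e y, of 3]]
      br_Lg[OF dp_Lg[OF e t, of 3] dp_Lg[OF e y, of 2]] br_Lg[OF dp_Lg[OF e t, of 4] dp_Lg[OF e y, of 1]]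
    by (intro Lg_add) simp_all
  moreover define s where "s = exp_defect t y"
  ultimately have s: "s \<in> Lg 2" by simp
  \<comment> \<open>\<open>(ad f)\<^sup>2\<close> is injective in degree 2, since \<open>[e, [f, s]] = 2 s\<close> and \<open>[e, [f, [f, s]]] = 3 [f, s]\<close>.\<close>
  have ffs: "br f (br f s) = 0" using 1 2 by (simp add: s_def)
  have "br e s = 0" using br_Lg[OF e s] Lg_outside[of 3] by simp
  then have efs: "br e (br f s) = 2 *s s" using br_f_e[OF s] by simp
  have fs: "br f s \<in> Lg 1" using br_Lg[OF f s] by simp
  have "2 *s br f s = br f (br e (br f s))" using efs Lg_subset[OF s] by simp
  also have "\<dots> = - br f s" using br_f_e[OF fs] ffs by simp
  finally have "3 *s br f s = 3 *s 0" by (simp add: multiples)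
  then have "br f s = 0" by (rule cancel_multiple[rotated]) simp
  then have "2 *s s = 2 *s 0" using efs by simp
  then show ?thesis unfolding s_def[symmetric] by (rule cancel_multiple[rotated]) simp
qed

lemma exp_hom_homogeneous:
  assumes a: "a \<in> Lg i" and b: "b \<in> Lg j"
  shows "exp_ad sc br e (br a b) = br (exp_ad sc br e a) (exp_ad sc br e b)"
proof -
  note [simp del] = One_nat_def
  let ?E = "exp_ad sc br e"
  have high: "br (dp e m a) (dp e n b) = 0" if "a \<in> Lg i" "b \<in> Lg j" "i + j + int m + int n > 2" for m n a b i j
  proof -
    have "br (dp e m a) (dp e n b) \<in> Lg ((i + int m * 1) + (j + int n * 1))"
      by (intro br_Lg dp_Lg e that)
    then show ?thesis using Lg_outside[of "i + j + int m + int n"] that(3) by (simp add: algebra_simps)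
  qed
  have easy: "?E (br a b) = br (?E a) (?E b)" if "a \<in> Lg i" "b \<in> Lg j" "i + j \<ge> -2" for a b i j
    using exp_br_expand[of e a b] Lg_subset that by (simp add: high[OF that(1,2)])
  have mixed: "?E (br t y) = br (?E t) (?E y)" if "t \<in> Lg (-2)" "y \<in> Lg (-1)" for t y
    using exp_br_expand[of e t y] Lg_subset that exp_defect_vanishes[OF that]
    by (simp add: high[OF that] exp_defect_def)
  have jac: "br (br u v) w = br u (br v w) - br v (br u w)" if "u \<in> L" "v \<in> L" "w \<in> L" for u v w
    using jacobi[OF that] by simp
  consider "i < -2 \<or> j < -2" | "i + j \<ge> -2" | "i = -2" "j = -1" | "i = -1" "j = -2" | "i = -2" "j = -2"
    by linarith
  then show ?thesis
  proof cases
    case 1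
    then have "a = 0 \<or> b = 0" using a b Lg_outside by blast
    then show ?thesis using Lg_subset[OF a] Lg_subset[OF b] by (auto simp: exp_ad_dp)
  next
    case 2
    then show ?thesis using easy a b by blast
  next
    case 3
    then show ?thesis using mixed a b by blast
  next
    case 4
    then have L [simp]: "a \<in> L" "b \<in> L" and "?E (br b a) = br (?E b) (?E a)"
      using mixed a b Lg_subset by blast+
    then show ?thesis using br_antisym[of a b] br_antisym[of "?E a" "?E b"] exp_scale[of e "br b a" "-1"] by simp
  next
    case 5
    \<comment> \<open>\<open>b = [f, c]\<close> is a bracket of elements of degree \<open>-1\<close>, for which the claim is already known.\<close>
    define c where "c = (1/2) *s br e b"
    have c: "c \<in> Lg (-1)" unfolding c_def using 5 br_Lg[OF e b] by (intro Lg_scale) simp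
    have L [simp]: "a \<in> L" "b \<in> L" "c \<in> L" using a b c Lg_subset by blast+
    have a2: "a \<in> Lg (-2)" using a 5 by simp
    have low: "br f b = 0" "br a f = 0" "br a c = 0" "br a b = 0"
      using br_Lg[OF f b] br_Lg[OF a f] br_Lg[OF a c] br_Lg[OF a b] 5 Lg_outside by auto
    have bc: "b = br f c"
      using br_f_e[OF b] low 5 two by (simp add: c_def)
    have "?E b = br (?E f) (?E c)" unfolding bc using easy[OF f c] by simp
    then have "br (?E a) (?E b) = br (br (?E a) (?E f)) (?E c) + br (?E f) (br (?E a) (?E c))"
      using jacobi[of "?E a" "?E f" "?E c"] by simp
    also have "\<dots> = 0"
      using mixed[OF a2 f] mixed[OF a2 c] low by (simp add: exp_ad_dp)
    finally show ?thesis using low by (simp add: exp_ad_dp)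
  qed
qed

theorem lie_automorphism_exp_degree_1: "lie_automorphism sc L br (exp_ad sc br e)"
  by (rule lie_automorphism_exp[OF e]) (use exp_hom_bilinear exp_hom_homogeneous in \<open>auto\<close>)

end

theorem lie_automorphism_exp_positive:
  assumes x: "x \<in> Lg 1" and s: "s \<in> Lg 2"
    and grading: "x \<noteq> 0 \<Longrightarrow> \<exists>y\<in>Lg (-1). \<forall>i. \<forall>z\<in>Lg i. br (br x y) z = of_int i *s z"
  shows "lie_automorphism sc L br (exp_ad sc br (x + s))"
proof (cases "x = 0")
  case True
  then show ?thesis using lie_automorphism_exp_degree_2[OF s] by simp
next
  case False
  then obtain y where y: "y \<in> Lg (-1)" "\<And>i z. z \<in> Lg i \<Longrightarrow> br (br x y) z = of_int i *s z"
    using grading by blast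
  have "lie_automorphism sc L br (exp_ad sc br x)"
    by (rule lie_automorphism_exp_degree_1[OF x y])
  then show ?thesis using lie_automorphism_exp_degree_2[OF s]
    by (rule lie_automorphism_compose) (rule exp_sum[OF x s])
qed

end

subsection \<open>Reversing the grading\<close>

lemma (in graded_lie_algebra_5) graded_carrier_uminus: "graded_carrier (\<lambda>i. Lg (- i)) = L"
proof -
  have *: "(\<Sum>i=-2..2::int. f (- i)) = (\<Sum>i=-2..2. f i)" for f :: "int \<Rightarrow> 'l"
    by (rule sum.reindex_bij_witness[of _ uminus uminus]) auto
  have "z \<in> graded_carrier (\<lambda>i. G (- i))" if z: "z \<in> graded_carrier G" for z and G :: "int \<Rightarrow> 'l set"
  proof -
    obtain f where "\<forall>i\<in>{-2..2}. f i \<in> G i" "z = (\<Sum>i=-2..2. f i)"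
      using z by (auto simp: graded_carrier_def)
    then show ?thesis
      unfolding graded_carrier_def mem_Collect_eq
      by (intro exI[of _ "\<lambda>i. f (- i)"]) (simp add: *)
  qed
  from this[of _ Lg] this[of _ "\<lambda>i. Lg (- i)"] show ?thesis by (auto simp only: minus_minus)
qed

lemma (in graded_lie_algebra_5) graded_lie_algebra_5_uminus:
  "graded_lie_algebra_5 sc (\<lambda>i. Lg (- i)) br"
proof unfold_locales
  show "br a b \<in> Lg (- (i + j))" if "a \<in> Lg (- i)" "b \<in> Lg (- j)" for a b i j
    using br_Lg[OF that] by (simp add: algebra_simps)
  show "Lg (- i) = {0}" if "i < -2 \<or> 2 < i" for i
    using Lg_outside[of "- i"] that by auto
qed (intro subspace_Lg br_add_left br_scale_left br_antisym jacobi two three; simp only: graded_carrier_uminus)+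

theorem (in graded_lie_algebra_5) algebraic_5_gradedI:
  assumes "\<And>x. x \<in> Lg 1 \<Longrightarrow> x \<noteq> 0 \<Longrightarrow> \<exists>y\<in>Lg (-1). \<forall>i. \<forall>z\<in>Lg i. br (br x y) z = of_int i *s z"
    and "\<And>x. x \<in> Lg (-1) \<Longrightarrow> x \<noteq> 0 \<Longrightarrow> \<exists>y\<in>Lg 1. \<forall>i. \<forall>z\<in>Lg i. br (br x y) z = of_int (- i) *s z"
  shows "algebraic_5_graded sc Lg br"
proof -
  interpret neg: graded_lie_algebra_5 sc "\<lambda>i. Lg (- i)" br
    by (rule graded_lie_algebra_5_uminus)
  have "lie_automorphism sc L br (exp_ad sc br (x + s))" if "x \<in> Lg 1" "s \<in> Lg 2" for x s
    using lie_automorphism_exp_positive[OF that] assms(1) that by blast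
  moreover have "lie_automorphism sc L br (exp_ad sc br (x + s))" if "x \<in> Lg (-1)" "s \<in> Lg (-2)" for x s
  proof -
    have "\<exists>y\<in>Lg 1. \<forall>i. \<forall>z\<in>Lg (- i). br (br x y) z = of_int i *s z" if "x \<noteq> 0"
      using assms(2)[OF \<open>x \<in> Lg (-1)\<close> that] by (metis minus_minus)
    then show ?thesis
      using neg.lie_automorphism_exp_positive[of x s] that by (simp add: graded_carrier_uminus)
  qed
  ultimately show ?thesis unfolding algebraic_5_graded_def by auto
qed

section \<open>Operators in the inner structure algebra\<close>

locale structurable_algebra_char = structurable_algebra scale mult one cnj
  for scale :: "'k::field \<Rightarrow> 'a::ab_group_add \<Rightarrow> 'a" (infixr "*s" 75)
    and mult (infixl "\<cdot>" 70) and one ("\<one>") and cnj +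
  assumes two: "(2::'k) \<noteq> 0" and three: "(3::'k) \<noteq> 0"
begin

lemma fun_scale_apply: "fun_scale c f z = c *s f z"
  by (simp add: fun_scale_def)

lemma Instrl_closed [simp]:
  "V a b \<in> Instrl" "f \<in> Instrl \<Longrightarrow> g \<in> Instrl \<Longrightarrow> f + g \<in> Instrl" "f \<in> Instrl \<Longrightarrow> fun_scale c f \<in> Instrl"
  "0 \<in> Instrl"
proof -
  interpret funs: vector_space fun_scale by (rule fun_vector_space)
  show "V a b \<in> Instrl" unfolding Instrl_def by (rule funs.span_base) blast
  show "f + g \<in> Instrl" if "f \<in> Instrl" "g \<in> Instrl"
    using that unfolding Instrl_def by (rule funs.span_add)
  show "fun_scale c f \<in> Instrl" if "f \<in> Instrl"
    using that unfolding Instrl_def by (rule funs.span_scale)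
  show "0 \<in> Instrl" unfolding Instrl_def by (rule funs.span_zero)
qed

lemma Instrl_induct [consumes 1, case_names V add scale]:
  assumes "D \<in> Instrl" "\<And>a b. P (V a b)"
    "\<And>f g. f \<in> Instrl \<Longrightarrow> g \<in> Instrl \<Longrightarrow> P f \<Longrightarrow> P g \<Longrightarrow> P (f + g)"
    "\<And>c f. f \<in> Instrl \<Longrightarrow> P f \<Longrightarrow> P (fun_scale c f)"
  shows "P D"
proof -
  interpret funs: vector_space fun_scale by (rule fun_vector_space)
  have "P 0" using assms(4)[of "V 0 0" 0] assms(2) by simp
  then have "funs.subspace {f. f \<in> Instrl \<and> P f}"
    by (intro funs.subspaceI) (use assms(3,4) in \<open>auto simp del: plus_fun_apply\<close>)
  then have "funs.span {V x y | x y. True} \<subseteq> {f. f \<in> Instrl \<and> P f}"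
    by (rule funs.span_minimal[rotated]) (use assms(2) in auto)
  then show ?thesis using assms(1) by (auto simp: Instrl_def)
qed

lemma Instrl_linear:
  assumes "D \<in> Instrl"
  shows "D (u + v) = D u + D v" "D (c *s u) = c *s D u"
proof -
  have "(\<forall>u v. D (u + v) = D u + D v) \<and> (\<forall>c u. D (c *s u) = c *s D u)"
    using assms
    by (induction rule: Instrl_induct)
      (auto simp: V_def mult_add_left mult_add_right mult_scale_left mult_scale_right fun_scale_apply
        scale_right_distrib scale_right_diff_distrib algebra_simps)
  then show "D (u + v) = D u + D v" "D (c *s u) = c *s D u" by blast+
qed

lemma Instrl_linear_derived:
  assumes "D \<in> Instrl"
  shows "D 0 = 0" "D (- u) = - D u" "D (u - v) = D u - D v"
proof -
  show "D 0 = 0" using Instrl_linear(2)[OF assms, of 0 0] by simp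
  show m: "D (- u) = - D u" for u using Instrl_linear(2)[OF assms, of "-1" u] by simp
  show "D (u - v) = D u - D v" using Instrl_linear(1)[OF assms, of u "- v"] m by simp
qed

text \<open>
  Any linear map with the prescribed values on the \<open>V a b\<close> computes the chosen extension on \<open>Instrl\<close>; the explicit
  formulas for the three actions follow.
\<close>

lemma V_extension_Instrl:
  assumes "Vector_Spaces.linear fun_scale scale f" "\<And>a b. f (V a b) = \<phi> a b" "D \<in> Instrl"
  shows "V_extension \<phi> D = f D"
  unfolding V_extension_def
proof (rule someI2[of _ f])
  fix g assume g: "Vector_Spaces.linear fun_scale (*s) g \<and> (\<forall>a b. g (V a b) = \<phi> a b)"
  interpret f: Vector_Spaces.linear fun_scale scale f by fact
  interpret g: Vector_Spaces.linear fun_scale scale g using g by blast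
  show "g D = f D"
    using assms(3) by (induction rule: Instrl_induct) (use g assms(2) in \<open>auto simp: f.add g.add f.scale g.scale simp del: plus_fun_apply\<close>)
qed (use assms in auto)

lemma act_minus1_eq:
  assumes "D \<in> Instrl"
  shows "act_minus1 D y = D y - (D \<one> + cnj (D \<one>)) \<cdot> y"
  unfolding act_minus1_def
  by (rule V_extension_Instrl[OF _ _ assms, where f = "\<lambda>D. D y - (D \<one> + cnj (D \<one>)) \<cdot> y"], rule linear_fun_scaleI)
    (simp_all add: fun_scale_apply alg_simps cnj_scale mult_scale_left scale_right_diff_distrib
      scale_right_distrib)

lemma act_minus1_linear:
  assumes "f \<in> Instrl"
  shows "g \<in> Instrl \<Longrightarrow> act_minus1 (f + g) = act_minus1 f + act_minus1 g"
    "act_minus1 (fun_scale c f) = fun_scale c (act_minus1 f)"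
proof -
  show "act_minus1 (f + g) = act_minus1 f + act_minus1 g" if "g \<in> Instrl"
    using assms that by (simp add: fun_eq_iff act_minus1_eq mult_add_left cnj_add algebra_simps)
  have "act_minus1 (fun_scale c f) x = fun_scale c (act_minus1 f) x" for x
    unfolding act_minus1_eq[OF Instrl_closed(3)[OF assms]] fun_scale_apply act_minus1_eq[OF assms]
    by (simp add: mult_add_left cnj_scale mult_scale_left scale_right_distrib scale_right_diff_distrib)
  then show "act_minus1 (fun_scale c f) = fun_scale c (act_minus1 f)" by (simp add: fun_eq_iff)
qed

lemma act_minus1_V_fun: "act_minus1 (V a b) = fun_scale (-1) (V b a)"
  by (simp add: fun_eq_iff act_minus1_V fun_scale_apply)

lemma act_minus1_Instrl [simp]: "D \<in> Instrl \<Longrightarrow> act_minus1 D \<in> Instrl"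
  by (induction rule: Instrl_induct) (simp_all add: act_minus1_V_fun act_minus1_linear del: plus_fun_apply)

lemma fun_scale_uminus_one [simp]: "fun_scale (-1) (fun_scale (-1) f) = f"
  by (simp add: fun_eq_iff fun_scale_apply)

text \<open>
  Thus \<open>D \<mapsto> act_minus1 D\<close> is an involution of \<open>Instrl\<close>, mapping \<open>V a b\<close> to \<open>- V b a\<close>. By
  \<open>act_minus2_eq\<close> it interchanges the actions on the two components of skew elements, and by
  \<open>commutator_Instrl\<close> it is a Lie algebra automorphism.
\<close>

lemma act_minus1_involution [simp]: "D \<in> Instrl \<Longrightarrow> act_minus1 (act_minus1 D) = D"
  by (induction rule: Instrl_induct) (simp_all add: act_minus1_V_fun act_minus1_linear del: plus_fun_apply)

lemma act_plus2_eq: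
  assumes "D \<in> Instrl" "s \<in> Skew"
  shows "act_plus2 D s = D s + s \<cdot> cnj (D \<one>)"
  unfolding act_plus2_def
  by (rule V_extension_Instrl[OF _ _ assms(1), where f = "\<lambda>D. D s + s \<cdot> cnj (D \<one>)"], rule linear_fun_scaleI)
    (simp_all add: V_plus2[OF two three assms(2)] fun_scale_apply mult_add_right cnj_add cnj_scale mult_scale_right
      scale_right_distrib algebra_simps)

lemma act_minus2_eq:
  assumes D: "D \<in> Instrl" and t: "t \<in> Skew"
  shows "act_minus2 D t = act_plus2 (act_minus1 D) t"
proof -
  define E where "E D y = D y - (D \<one> + cnj (D \<one>)) \<cdot> y" for D y
  have E: "E (V a b) y = - V b a y" for a b y
    by (simp add: E_def alg_simps)
  have "act_minus2 D t = E D t + t \<cdot> cnj (E D \<one>)"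
    unfolding act_minus2_def
  proof (rule V_extension_Instrl[OF _ _ D, where f = "\<lambda>D. E D t + t \<cdot> cnj (E D \<one>)"], rule linear_fun_scaleI)
    show "E (V a b) t + t \<cdot> cnj (E (V a b) \<one>) = \<psi> b (t \<cdot> a)" for a b
    proof -
      have "E (V a b) t + t \<cdot> cnj (E (V a b) \<one>) = - (V b a t + t \<cdot> cnj (V b a \<one>))"
        by (simp add: E)
      then show ?thesis by (simp add: V_plus2[OF two three t])
    qed
  qed (simp_all add: E_def fun_scale_apply mult_add_right mult_add_left mult_diff cnj_add cnj_diff cnj_cnj cnj_mult
      cnj_scale mult_scale_left mult_scale_right scale_right_distrib scale_right_diff_distrib)
  also have "\<dots> = act_plus2 (act_minus1 D) t"
    using D t by (simp add: act_plus2_eq E_def flip: act_minus1_eq)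
  finally show ?thesis .
qed

lemmas act_V = act_minus1_V act_plus2_V[OF two three] act_minus2_V[OF two three]

lemma commutator_Instrl:
  assumes "D \<in> Instrl" "D' \<in> Instrl"
  shows "(\<lambda>z. D (D' z) - D' (D z)) \<in> Instrl"
    "act_minus1 (\<lambda>z. D (D' z) - D' (D z)) = (\<lambda>z. act_minus1 D (act_minus1 D' z) - act_minus1 D' (act_minus1 D z))"
proof -
  let ?C = "\<lambda>D D'. (\<lambda>z. D (D' z) - D' (D z))"
  have VV: "?C (V a b) (V c d) = V (V a b c) d + fun_scale (-1) (V c (V b a d))" for a b c d
    by (simp add: fun_eq_iff structurable fun_scale_apply)
  have add: "?C f (g + h) = ?C f g + ?C f h" "?C (g + h) f = ?C g f + ?C h f" if "f \<in> Instrl" for f g h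
    using that by (simp_all add: fun_eq_iff Instrl_linear)
  have scale: "?C f (fun_scale c g) = fun_scale c (?C f g)" "?C (fun_scale c g) f = fun_scale c (?C g f)"
    if "f \<in> Instrl" for f g c
    using that by (simp_all add: fun_eq_iff fun_scale_apply Instrl_linear scale_right_diff_distrib)
  have "?C D D' \<in> Instrl \<and> act_minus1 (?C D D') = ?C (act_minus1 D) (act_minus1 D')"
    using assms(1)
  proof (induction rule: Instrl_induct)
    case (V a b)
    show ?case using assms(2)
    proof (induction rule: Instrl_induct)
      case (V c d)
      have "?C (V b a) (V d c) = V (V b a d) c + fun_scale (-1) (V d (V a b c))" by (rule VV)
      then show ?case
        by (simp add: VV act_minus1_linear act_minus1_V_fun scale add.commute del: plus_fun_apply)
    qed (simp_all add: add scale act_minus1_linear del: plus_fun_apply)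
  qed (use assms(2) in \<open>simp_all add: add scale act_minus1_linear del: plus_fun_apply\<close>)
  then show "?C D D' \<in> Instrl" "act_minus1 (?C D D') = ?C (act_minus1 D) (act_minus1 D')" by blast+
qed

lemma Skew_closed [simp]:
  "s \<in> Skew \<Longrightarrow> t \<in> Skew \<Longrightarrow> s + t \<in> Skew" "s \<in> Skew \<Longrightarrow> c *s s \<in> Skew" "0 \<in> Skew"
  "s \<in> Skew \<Longrightarrow> - s \<in> Skew" "s \<in> Skew \<Longrightarrow> t \<in> Skew \<Longrightarrow> s - t \<in> Skew" "\<psi> x y \<in> Skew"
  by (simp_all add: Skew_def cnj_add cnj_scale cnj_diff \<psi>_def cnj_mult cnj_cnj cnj_scale[of 0 0, simplified])

lemma act_Skew [simp]:
  assumes "D \<in> Instrl" "s \<in> Skew"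
  shows "act_plus2 D s \<in> Skew" "act_minus2 D s \<in> Skew"
proof -
  have "act_plus2 D s \<in> Skew" if "D \<in> Instrl" for D
    using that
  proof (induction rule: Instrl_induct)
    case (V a b)
    then show ?case using assms(2) by (simp add: act_V)
  next
    case (add f g)
    have "act_plus2 (f + g) s = act_plus2 f s + act_plus2 g s"
      using add assms(2) by (simp add: act_plus2_eq cnj_add mult_add_right algebra_simps)
    then show ?case using add by (simp del: plus_fun_apply)
  next
    case (scale c f)
    have "act_plus2 (fun_scale c f) s = c *s act_plus2 f s"
      using scale assms(2) by (simp add: act_plus2_eq fun_scale_apply cnj_scale mult_scale_right scale_right_distrib)
    then show ?case using scale by simp
  qed
  then show "act_plus2 D s \<in> Skew" "act_minus2 D s \<in> Skew"
    using assms by (simp_all add: act_minus2_eq)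
qed


lemmas V_bilinear = mult_add_left mult_add_right mult_diff mult_scale_left mult_scale_right cnj_add cnj_scale cnj_diff
  scale_right_distrib scale_right_diff_distrib

lemma V_add:
  "V (x + x') y z = V x y z + V x' y z" "V x (y + y') z = V x y z + V x y' z"
  "V x y (z + z') = V x y z + V x y z'"
  by (simp_all add: V_def V_bilinear algebra_simps)

lemma V_scale:
  "V (c *s x) y z = c *s V x y z" "V x (c *s y) z = c *s V x y z" "V x y (c *s z) = c *s V x y z"
  by (simp_all add: V_def V_bilinear)

lemma V_zero [simp]: "V 0 y = 0" "V x 0 = 0" "V x y 0 = 0"
  using V_scale(1)[of 0] V_scale(2)[of _ 0] V_scale(3)[of _ _ 0] by (simp_all add: fun_eq_iff)

lemma V_minus:
  "V (- x) y z = - V x y z" "V x (- y) z = - V x y z" "V x y (- z) = - V x y z"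
  using V_scale(1)[of "-1" x y z] V_scale(2)[of x "-1" y z] V_scale(3)[of x y "-1" z] by simp_all

lemma V_diff:
  "V (x - x') y z = V x y z - V x' y z" "V x (y - y') z = V x y z - V x y' z"
  "V x y (z - z') = V x y z - V x y z'"
  by (simp_all add: V_def V_bilinear algebra_simps)

lemma psi_add: "\<psi> (x + x') y = \<psi> x y + \<psi> x' y" "\<psi> x (y + y') = \<psi> x y + \<psi> x y'"
  by (simp_all add: \<psi>_def V_bilinear algebra_simps)

lemma psi_diff: "\<psi> (x - x') y = \<psi> x y - \<psi> x' y" "\<psi> x (y - y') = \<psi> x y - \<psi> x y'"
  by (simp_all add: \<psi>_def V_bilinear algebra_simps)

lemma psi_scale: "\<psi> (c *s x) y = c *s \<psi> x y" "\<psi> x (c *s y) = c *s \<psi> x y"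
  by (simp_all add: \<psi>_def V_bilinear)

lemma psi_minus: "\<psi> (- x) y = - \<psi> x y" "\<psi> x (- y) = - \<psi> x y"
  using psi_scale(1)[of "-1" x y] psi_scale(2)[of x "-1" y] by simp_all

lemma psi_zero [simp]: "\<psi> 0 y = 0" "\<psi> x 0 = 0"
  using psi_scale(1)[of 0] psi_scale(2)[of _ 0] by simp_all

lemma psi_antisym: "\<psi> x y = - \<psi> y x"
  by (simp add: \<psi>_def)

lemma act_plus2_add: "f \<in> Instrl \<Longrightarrow> g \<in> Instrl \<Longrightarrow> s \<in> Skew \<Longrightarrow> act_plus2 (f + g) s = act_plus2 f s + act_plus2 g s"
  "f \<in> Instrl \<Longrightarrow> s \<in> Skew \<Longrightarrow> t \<in> Skew \<Longrightarrow> act_plus2 f (s + t) = act_plus2 f s + act_plus2 f t"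
  by (simp_all add: act_plus2_eq V_bilinear Instrl_linear algebra_simps)

lemma act_plus2_scale: "f \<in> Instrl \<Longrightarrow> s \<in> Skew \<Longrightarrow> act_plus2 (fun_scale c f) s = c *s act_plus2 f s"
  "f \<in> Instrl \<Longrightarrow> s \<in> Skew \<Longrightarrow> act_plus2 f (c *s s) = c *s act_plus2 f s"
  by (simp_all add: act_plus2_eq V_bilinear Instrl_linear fun_scale_apply)

lemma act_minus2_add: "f \<in> Instrl \<Longrightarrow> g \<in> Instrl \<Longrightarrow> s \<in> Skew \<Longrightarrow> act_minus2 (f + g) s = act_minus2 f s + act_minus2 g s"
  "f \<in> Instrl \<Longrightarrow> s \<in> Skew \<Longrightarrow> t \<in> Skew \<Longrightarrow> act_minus2 f (s + t) = act_minus2 f s + act_minus2 f t"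
  by (simp_all add: act_minus2_eq act_minus1_linear act_plus2_add del: plus_fun_apply)

lemma act_minus2_scale: "f \<in> Instrl \<Longrightarrow> s \<in> Skew \<Longrightarrow> act_minus2 (fun_scale c f) s = c *s act_minus2 f s"
  "f \<in> Instrl \<Longrightarrow> s \<in> Skew \<Longrightarrow> act_minus2 f (c *s s) = c *s act_minus2 f s"
  by (simp_all add: act_minus2_eq act_minus1_linear act_plus2_scale)

text \<open>The same with sums and multiples of operators written pointwise.\<close>

lemmas act_linear_pointwise =
  act_plus2_add(1)[unfolded plus_fun_def] act_plus2_scale(1)[unfolded fun_scale_def]
  act_minus1_linear[unfolded plus_fun_def fun_scale_def]

lemma act_minus:
  assumes "f \<in> Instrl"
  shows "s \<in> Skew \<Longrightarrow> act_plus2 f (- s) = - act_plus2 f s" "s \<in> Skew \<Longrightarrow> act_minus2 f (- s) = - act_minus2 f s"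
    "act_minus1 f (- y) = - act_minus1 f y"
  using act_plus2_scale(2)[OF assms, of s "-1"] act_minus2_scale(2)[OF assms, of s "-1"]
    Instrl_linear_derived(2)[OF act_minus1_Instrl[OF assms]] by simp_all

lemma act_zero [simp]:
  "s \<in> Skew \<Longrightarrow> act_plus2 0 s = 0" "s \<in> Skew \<Longrightarrow> act_minus2 0 s = 0" "act_minus1 0 y = 0"
  "D \<in> Instrl \<Longrightarrow> act_plus2 D 0 = 0" "D \<in> Instrl \<Longrightarrow> act_minus2 D 0 = 0" "D \<in> Instrl \<Longrightarrow> act_minus1 D 0 = 0"
proof -
  have c: "cnj 0 = 0" using cnj_scale[of 0 0] by simp
  show p: "act_plus2 0 s = 0" if "s \<in> Skew" using that by (simp add: act_plus2_eq c)
  show m: "act_minus1 0 y = 0" for y by (simp add: act_minus1_eq c)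
  have "act_minus1 0 = 0" using m by (simp add: fun_eq_iff)
  then show "act_minus2 0 s = 0" if "s \<in> Skew" using that by (simp add: act_minus2_eq p)
  show "act_plus2 D 0 = 0" "act_minus2 D 0 = 0" "act_minus1 D 0 = 0" if "D \<in> Instrl"
    using that by (simp_all add: act_minus2_eq act_plus2_eq act_minus1_eq Instrl_linear_derived)
qed

subsection \<open>Identities behind the Jacobi identity\<close>

text \<open>
  The next four lemmas say that \<open>D\<close> acts as a derivation on the products \<open>[x\<^sub>+, y\<^sub>+]\<close>, \<open>[x\<^sub>+, y\<^sub>-]\<close>, \<open>[s\<^sub>+, y\<^sub>-]\<close>
  and \<open>[t\<^sub>-, x\<^sub>+]\<close>.
\<close>

lemma act_plus2_psi:
  assumes "D \<in> Instrl"
  shows "act_plus2 D (\<psi> x y) = \<psi> (D x) y + \<psi> x (D y)"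
  using assms
proof (induction rule: Instrl_induct)
  case (V a b)
  have "cnj (V a b \<one>) = V b a \<one>" by (simp add: alg_simps)
  then show ?case
    using V_psi[of a b x y \<one>] by (simp add: act_plus2_eq mult_one)
qed (simp_all add: act_linear_pointwise psi_add psi_scale fun_scale_apply scale_right_distrib algebra_simps)

lemma Instrl_V:
  assumes "D \<in> Instrl"
  shows "D (V x y z) = V (D x) y z + V x (act_minus1 D y) z + V x y (D z)"
  using assms
proof (induction rule: Instrl_induct)
  case (V a b)
  then show ?case using structurable[of a b x y z] by (simp add: act_minus1_V V_minus algebra_simps)
qed (simp_all add: act_linear_pointwise V_add V_scale fun_scale_apply scale_right_distrib algebra_simps)

lemma Instrl_mult_Skew:
  assumes "D \<in> Instrl" "s \<in> Skew"
  shows "D (s \<cdot> y) = act_plus2 D s \<cdot> y + s \<cdot> act_minus1 D y"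
  using assms(1)
proof (induction rule: Instrl_induct)
  case (V a b)
  have "cnj (V a b \<one>) = V b a \<one>" by (simp add: alg_simps)
  then show ?case
    using V_skew[OF two three assms(2), of a b y] assms(2)
    by (simp add: act_plus2_eq act_minus1_V eq_diff_eq)
qed (use assms(2) in \<open>simp_all add: act_linear_pointwise V_bilinear fun_scale_apply algebra_simps\<close>)

lemma act_minus1_mult_Skew:
  assumes "D \<in> Instrl" "t \<in> Skew"
  shows "act_minus1 D (t \<cdot> x) = act_minus2 D t \<cdot> x + t \<cdot> D x"
  using Instrl_mult_Skew[of "act_minus1 D" t x] assms by (simp add: act_minus2_eq)

lemma Skew_mult_V:
  assumes "s \<in> Skew"
  shows "s \<cdot> V b a z = V (s \<cdot> b) z a - V a z (s \<cdot> b) - V a b (s \<cdot> z)"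
proof -
  have "s \<cdot> V b a z = - (\<psi> a (s \<cdot> b) \<cdot> z) - V a b (s \<cdot> z)"
    using Instrl_mult_Skew[of "V a b" s z] assms by (simp add: act_V)
  then show ?thesis using V_swap[of a z "s \<cdot> b"] by (simp add: algebra_simps)
qed

text \<open>
  Antisymmetrising the previous identity in \<open>b\<close> and \<open>z\<close> gives \<open>L\<^sub>s L\<^bsub>\<psi>(x, y)\<^esub>\<close>; the involution of \<open>Instrl\<close>, which maps
  \<open>L\<^sub>s L\<^sub>t\<close> to \<open>- L\<^sub>t L\<^sub>s\<close>, then gives \<open>L\<^bsub>\<psi>(x, y)\<^esub> L\<^sub>t\<close>.
\<close>

lemma Skew_mult_psi:
  assumes "s \<in> Skew"
  shows "s \<cdot> (\<psi> x y \<cdot> z) = V (s \<cdot> x) y z - V (s \<cdot> y) x z"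
  using Skew_mult_V[OF assms, of x z y] Skew_mult_V[OF assms, of y z x]
  by (simp add: mult_diff flip: V_swap)

lemma Skew_Skew_Instrl:
  assumes "s \<in> Skew" "t \<in> Skew"
  shows "(\<lambda>z. s \<cdot> (t \<cdot> z)) \<in> Instrl" "act_minus1 (\<lambda>z. s \<cdot> (t \<cdot> z)) y = - (t \<cdot> (s \<cdot> y))"
proof -
  show *: "(\<lambda>z. s \<cdot> (t \<cdot> z)) \<in> Instrl" by (rule L_L_in_Instrl[OF two three assms])
  have "cnj (s \<cdot> t) = t \<cdot> s" using assms by (simp add: Skew_def cnj_mult)
  moreover have "assoc s t y = - assoc t s y" by (rule skew_alternative[OF two three assms(1)])
  ultimately show "act_minus1 (\<lambda>z. s \<cdot> (t \<cdot> z)) y = - (t \<cdot> (s \<cdot> y))"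
    unfolding act_minus1_eq[OF *] by (simp add: assoc_def mult_one mult_add_left algebra_simps)
qed

lemma psi_mult_Skew:
  assumes "t \<in> Skew"
  shows "\<psi> x y \<cdot> (t \<cdot> z) = V y (t \<cdot> x) z - V x (t \<cdot> y) z"
proof -
  have "(\<lambda>z. t \<cdot> (\<psi> x y \<cdot> z)) = V (t \<cdot> x) y + fun_scale (-1) (V (t \<cdot> y) x)"
    by (simp add: fun_eq_iff Skew_mult_psi[OF assms] fun_scale_apply)
  then have "act_minus1 (\<lambda>z. t \<cdot> (\<psi> x y \<cdot> z)) z = act_minus1 (V (t \<cdot> x) y + fun_scale (-1) (V (t \<cdot> y) x)) z"
    by (simp del: plus_fun_apply)
  then show ?thesis
    using assms by (simp add: Skew_Skew_Instrl act_minus1_linear act_minus1_V fun_scale_apply)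
      (metis minus_diff_eq minus_minus)
qed

section \<open>The Lie algebra of a structurable algebra\<close>

text \<open>The tuples that belong to \<open>K(A)\<close>.\<close>

definition K_carrier :: "('a \<times> 'a \<times> ('a \<Rightarrow> 'a) \<times> 'a \<times> 'a) set" where
  "K_carrier = {(t, y, D, x, s) | t y D x s. t \<in> Skew \<and> D \<in> Instrl \<and> s \<in> Skew}"

lemma K_carrier_iff [simp]: "(t, y, D, x, s) \<in> K_carrier \<longleftrightarrow> t \<in> Skew \<and> D \<in> Instrl \<and> s \<in> Skew"
  by (simp add: K_carrier_def)

lemma K_carrierE:
  assumes "u \<in> K_carrier"
  obtains t y D x s where "u = (t, y, D, x, s)" "t \<in> Skew" "D \<in> Instrl" "s \<in> Skew"
  using assms by (auto simp: K_carrier_def)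

text \<open>The component of degree 0 of a bracket lies in \<open>Instrl\<close>, and its image under the involution of \<open>Instrl\<close>.\<close>

lemma K_bracket_degree_0:
  assumes "t \<in> Skew" "t' \<in> Skew" "D \<in> Instrl" "D' \<in> Instrl" "s \<in> Skew" "s' \<in> Skew"
  shows "(\<lambda>z. D (D' z) - D' (D z) + V x y' z - V x' y z + s \<cdot> (t' \<cdot> z) - s' \<cdot> (t \<cdot> z)) \<in> Instrl"
    (is "?F \<in> _")
    and "act_minus1 (\<lambda>z. D (D' z) - D' (D z) + V x y' z - V x' y z + s \<cdot> (t' \<cdot> z) - s' \<cdot> (t \<cdot> z)) w
      = act_minus1 D (act_minus1 D' w) - act_minus1 D' (act_minus1 D w) - V y' x w + V y x' w
        - t' \<cdot> (s \<cdot> w) + t \<cdot> (s' \<cdot> w)"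
proof -
  let ?C = "\<lambda>z. D (D' z) - D' (D z)" and ?L = "\<lambda>z. s \<cdot> (t' \<cdot> z)" and ?L' = "\<lambda>z. s' \<cdot> (t \<cdot> z)"
  have C: "?C \<in> Instrl" "act_minus1 ?C = (\<lambda>z. act_minus1 D (act_minus1 D' z) - act_minus1 D' (act_minus1 D z))"
    using commutator_Instrl assms by blast+
  have L: "?L \<in> Instrl" "?L' \<in> Instrl" using Skew_Skew_Instrl assms by blast+
  have F: "?F = ?C + V x y' + fun_scale (-1) (V x' y) + ?L + fun_scale (-1) ?L'"
    by (simp add: fun_eq_iff fun_scale_apply)
  show I: "?F \<in> Instrl" unfolding F using C L by (intro Instrl_closed)
  have "act_minus1 ?F = act_minus1 ?C + act_minus1 (V x y') + fun_scale (-1) (act_minus1 (V x' y))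
    + act_minus1 ?L + fun_scale (-1) (act_minus1 ?L')"
    unfolding F using C(1) L by (simp only: act_minus1_linear Instrl_closed)
  then show "act_minus1 ?F w = act_minus1 D (act_minus1 D' w) - act_minus1 D' (act_minus1 D w) - V y' x w + V y x' w
        - t' \<cdot> (s \<cdot> w) + t \<cdot> (s' \<cdot> w)"
    using assms by (simp add: C(2) act_minus1_V fun_scale_apply Skew_Skew_Instrl)
qed

lemma K_bracket_closed:
  assumes "u \<in> K_carrier" "v \<in> K_carrier"
  shows "K_bracket u v \<in> K_carrier"
  using assms by (elim K_carrierE) (simp add: K_bracket_degree_0(1))

lemma K_bracket_plus1:
  assumes "v \<in> K_carrier" "v = (t, y, D, p, s)"
  shows "K_bracket (0, 0, 0, x, 0) v = (0, - (t \<cdot> x), V x y, - D x, \<psi> x p)"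
  using assms by (auto simp: fun_eq_iff Instrl_linear_derived)

lemma K_jacobi_plus1:
  assumes "u \<in> K_carrier" "v \<in> K_carrier"
  shows "K_bracket (0, 0, 0, x, 0) (K_bracket u v)
    = K_bracket (K_bracket (0, 0, 0, x, 0) u) v + K_bracket u (K_bracket (0, 0, 0, x, 0) v)"
proof -
  obtain t y D p s where u: "u = (t, y, D, p, s)" and [simp]: "t \<in> Skew" "D \<in> Instrl" "s \<in> Skew"
    using assms(1) by (rule K_carrierE)
  obtain t' y' D' p' s' where v: "v = (t', y', D', p', s')" and [simp]: "t' \<in> Skew" "D' \<in> Instrl" "s' \<in> Skew"
    using assms(2) by (rule K_carrierE)
  have uv: "K_bracket (0, 0, 0, x, 0) u = (0, - (t \<cdot> x), V x y, - D x, \<psi> x p)"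
    "K_bracket (0, 0, 0, x, 0) v = (0, - (t' \<cdot> x), V x y', - D' x, \<psi> x p')"
    using K_bracket_plus1 assms u v by blast+
  have [simp]: "(\<lambda>z. D (D' z) - D' (D z) + V p y' z - V p' y z + s \<cdot> (t' \<cdot> z) - s' \<cdot> (t \<cdot> z)) \<in> Instrl"
    by (rule K_bracket_degree_0) simp_all
  have psi: "\<psi> (- (t \<cdot> x)) y' = \<psi> y' (t \<cdot> x)" "\<psi> p (- D' x) = \<psi> (D' x) p"
    using psi_antisym[of "t \<cdot> x" y'] psi_antisym[of p "D' x"] by (simp_all add: psi_minus)
  have swap: "V y' x y = V y x y' - \<psi> y y' \<cdot> x" "V x y p' = V p' y x + \<psi> x p' \<cdot> y"
    "V x y' p = V p y' x + \<psi> x p \<cdot> y'"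
    using V_swap[of y x y'] V_swap[of x y p'] V_swap[of x y' p] by (simp_all add: diff_eq_eq add.commute)
  show ?thesis
    unfolding uv unfolding u v K_bracket.simps plus_prod_def fst_conv snd_conv prod.inject
    by (intro conjI; simp add: fun_eq_iff act_V act_minus Instrl_linear_derived psi)
      (simp_all add: psi_minus psi_add psi_diff act_minus1_mult_Skew swap act_plus2_psi mult_add_left mult_diff
          V_add V_minus V_diff Instrl_V psi_mult_Skew)
qed

lemma K_bracket_antisym: "u \<in> K_carrier \<Longrightarrow> v \<in> K_carrier \<Longrightarrow> K_bracket u v = - K_bracket v u"
  by (elim K_carrierE) (auto simp: fun_eq_iff intro: psi_antisym)

lemma K_carrier_add [simp]: "u \<in> K_carrier \<Longrightarrow> v \<in> K_carrier \<Longrightarrow> u + v \<in> K_carrier"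
  by (elim K_carrierE) (simp del: plus_fun_apply)

lemma K_carrier_scale [simp]: "u \<in> K_carrier \<Longrightarrow> K_scale c u \<in> K_carrier"
  by (elim K_carrierE) simp

lemma K_bracket_add_left:
  assumes "u \<in> K_carrier" "v \<in> K_carrier" "w \<in> K_carrier"
  shows "K_bracket (u + v) w = K_bracket u w + K_bracket v w"
  using assms
  by (elim K_carrierE)
    (simp add: fun_eq_iff act_minus2_add act_plus2_add act_minus1_linear Instrl_linear psi_add V_add mult_add_left
      mult_add_right)

lemma K_bracket_scale_left:
  assumes "u \<in> K_carrier" "v \<in> K_carrier"
  shows "K_bracket (K_scale c u) v = K_scale c (K_bracket u v)"
  using assms
  by (elim K_carrierE)
    (simp add: fun_eq_iff fun_scale_apply act_minus2_scale act_plus2_scale act_minus1_linear Instrl_linear psi_scale V_scale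
      mult_scale_left mult_scale_right scale_right_distrib scale_right_diff_distrib)

text \<open>The grade-reversing automorphism of \<open>K(A)\<close>.\<close>

fun K_swap :: "'a \<times> 'a \<times> ('a \<Rightarrow> 'a) \<times> 'a \<times> 'a \<Rightarrow> 'a \<times> 'a \<times> ('a \<Rightarrow> 'a) \<times> 'a \<times> 'a" where
  "K_swap (t, y, D, x, s) = (s, x, act_minus1 D, y, t)"

lemma K_swap_closed [simp]: "u \<in> K_carrier \<Longrightarrow> K_swap u \<in> K_carrier"
  by (elim K_carrierE) simp

lemma K_swap_swap [simp]: "u \<in> K_carrier \<Longrightarrow> K_swap (K_swap u) = u"
  by (elim K_carrierE) simp

lemma K_swap_add: "u \<in> K_carrier \<Longrightarrow> v \<in> K_carrier \<Longrightarrow> K_swap (u + v) = K_swap u + K_swap v"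
  by (elim K_carrierE) (simp add: act_minus1_linear del: plus_fun_apply)

lemma K_swap_bracket:
  assumes "u \<in> K_carrier" "v \<in> K_carrier"
  shows "K_swap (K_bracket u v) = K_bracket (K_swap u) (K_swap v)"
proof -
  obtain t y D p s where u: "u = (t, y, D, p, s)" and [simp]: "t \<in> Skew" "D \<in> Instrl" "s \<in> Skew"
    using assms(1) by (rule K_carrierE)
  obtain t' y' D' p' s' where v: "v = (t', y', D', p', s')" and [simp]: "t' \<in> Skew" "D' \<in> Instrl" "s' \<in> Skew"
    using assms(2) by (rule K_carrierE)
  show ?thesis
    unfolding u v by (simp add: fun_eq_iff K_bracket_degree_0(2) act_minus2_eq)
qed

text \<open>
  \<open>w\<close> belongs to \<open>K(A)\<close> and \<open>ad w\<close> is a derivation. Such elements form a subalgebra; as it contains the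
  components of degree \<open>1\<close> and \<open>-1\<close>, it is all of \<open>K(A)\<close>.
\<close>

definition K_derivation :: "'a \<times> 'a \<times> ('a \<Rightarrow> 'a) \<times> 'a \<times> 'a \<Rightarrow> bool" where
  "K_derivation w \<longleftrightarrow> w \<in> K_carrier \<and> (\<forall>u\<in>K_carrier. \<forall>v\<in>K_carrier.
     K_bracket w (K_bracket u v) = K_bracket (K_bracket w u) v + K_bracket u (K_bracket w v))"

lemma K_bracket_right:
  assumes "u \<in> K_carrier" "v \<in> K_carrier" "w \<in> K_carrier"
  shows "K_bracket w (u + v) = K_bracket w u + K_bracket w v"
    "K_bracket w (K_scale c u) = K_scale c (K_bracket w u)"
proof -
  have neg: "K_scale c (- z) = - K_scale c z" for c z by (cases z) (simp add: fun_eq_iff fun_scale_apply)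
  show "K_bracket w (u + v) = K_bracket w u + K_bracket w v"
    using K_bracket_antisym[of w "u + v"] K_bracket_antisym[of w u] K_bracket_antisym[of w v]
      K_bracket_add_left[of u v w] assms by simp
  show "K_bracket w (K_scale c u) = K_scale c (K_bracket w u)"
    using K_bracket_antisym[of w "K_scale c u"] K_bracket_antisym[of w u]
      K_bracket_scale_left[of u w c] assms by (simp add: neg)
qed

lemma K_derivation_add: "K_derivation w \<Longrightarrow> K_derivation w' \<Longrightarrow> K_derivation (w + w')"
  unfolding K_derivation_def by (simp add: K_bracket_add_left K_bracket_right K_bracket_closed add_ac)

lemma K_derivation_scale: "K_derivation w \<Longrightarrow> K_derivation (K_scale c w)"
proof -
  have "K_scale c (u + v) = K_scale c u + K_scale c v" for u v
    by (cases u; cases v) (simp add: fun_eq_iff fun_scale_apply scale_right_distrib)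
  then show "K_derivation w \<Longrightarrow> K_derivation (K_scale c w)"
  unfolding K_derivation_def by (simp add: K_bracket_scale_left K_bracket_right K_bracket_closed)
qed

lemma K_derivation_bracket:
  assumes "K_derivation w" "K_derivation w'"
  shows "K_derivation (K_bracket w w')"
proof -
  have C: "w \<in> K_carrier" "w' \<in> K_carrier" using assms by (simp_all add: K_derivation_def)
  have D: "K_bracket w (K_bracket u v) = K_bracket (K_bracket w u) v + K_bracket u (K_bracket w v)"
    "K_bracket w' (K_bracket u v) = K_bracket (K_bracket w' u) v + K_bracket u (K_bracket w' v)"
    if "u \<in> K_carrier" "v \<in> K_carrier" for u v
    using assms that unfolding K_derivation_def by blast+
  have ad: "K_bracket (K_bracket w w') u = K_bracket w (K_bracket w' u) - K_bracket w' (K_bracket w u)"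
    if "u \<in> K_carrier" for u
    using D(1)[OF C(2) that] by simp
  have "K_bracket (K_bracket w w') (K_bracket u v)
    = K_bracket (K_bracket (K_bracket w w') u) v + K_bracket u (K_bracket (K_bracket w w') v)"
    if uv: "u \<in> K_carrier" "v \<in> K_carrier" for u v
  proof -
    note cl = uv C K_bracket_closed
    let ?b = K_bracket
    have 1: "?b w (?b w' (?b u v)) = ?b (?b w (?b w' u)) v + ?b (?b w' u) (?b w v)
      + (?b (?b w u) (?b w' v) + ?b u (?b w (?b w' v)))"
      using cl by (simp only: D(2)[of u v] D(1)[of "?b w' u" v] D(1)[of u "?b w' v"] K_bracket_right)
    have 2: "?b w' (?b w (?b u v)) = ?b (?b w' (?b w u)) v + ?b (?b w u) (?b w' v)
      + (?b (?b w' u) (?b w v) + ?b u (?b w' (?b w v)))"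
      using cl by (simp only: D(1)[of u v] D(2)[of "?b w u" v] D(2)[of u "?b w v"] K_bracket_right)
    have 3: "?b (?b w (?b w' u)) v = ?b (?b (?b w w') u) v + ?b (?b w' (?b w u)) v"
      using cl by (simp only: D(1)[of w' u] K_bracket_add_left)
    have 4: "?b u (?b w (?b w' v)) = ?b u (?b (?b w w') v) + ?b u (?b w' (?b w v))"
      using cl by (simp only: D(1)[of w' v] K_bracket_right)
    show ?thesis using cl ad[of "?b u v"] unfolding 1 2 3 4 by simp
  qed
  then show ?thesis unfolding K_derivation_def using C K_bracket_closed by blast
qed

lemma K_derivation_plus1: "K_derivation (0, 0, 0, x, 0)"
  unfolding K_derivation_def using K_jacobi_plus1 by simp

lemma K_derivation_minus1: "K_derivation (0, y, 0, 0, 0)"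
proof -
  let ?w = "(0, y, 0, 0, 0) :: 'a \<times> 'a \<times> ('a \<Rightarrow> 'a) \<times> 'a \<times> 'a" and ?x = "(0, 0, 0, y, 0) :: 'a \<times> 'a \<times> ('a \<Rightarrow> 'a) \<times> 'a \<times> 'a"
  have "act_minus1 0 = 0" by (simp add: fun_eq_iff)
  then have w: "?w = K_swap ?x" by simp
  have x: "?x \<in> K_carrier" by simp
  have "K_bracket ?w (K_bracket u v) = K_bracket (K_bracket ?w u) v + K_bracket u (K_bracket ?w v)"
    if uv: "u \<in> K_carrier" "v \<in> K_carrier" for u v
  proof -
    let ?u = "K_swap u" and ?v = "K_swap v"
    have [simp]: "?u \<in> K_carrier" "?v \<in> K_carrier" "K_bracket ?u ?v \<in> K_carrier"
      "K_bracket ?x ?u \<in> K_carrier" "K_bracket ?x ?v \<in> K_carrier"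
      using uv x K_bracket_closed by simp_all
    have br: "K_bracket ?w z = K_swap (K_bracket ?x (K_swap z))" if "z \<in> K_carrier" for z
      using K_swap_bracket[OF x K_swap_closed[OF that]] that w by simp
    have "K_bracket ?w (K_bracket u v) = K_swap (K_bracket ?x (K_bracket ?u ?v))"
      using br K_bracket_closed K_swap_bracket uv by simp
    also have "\<dots> = K_swap (K_bracket (K_bracket ?x ?u) ?v + K_bracket ?u (K_bracket ?x ?v))"
      by (subst K_jacobi_plus1) simp_all
    also have "\<dots> = K_bracket (K_swap (K_bracket ?x ?u)) v + K_bracket u (K_swap (K_bracket ?x ?v))"
      using uv by (subst K_swap_add) (simp_all add: K_bracket_closed K_swap_bracket)
    finally show ?thesis using br uv by simp
  qed
  then show ?thesis unfolding K_derivation_def by simp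
qed

lemma K_derivation:
  assumes "w \<in> K_carrier"
  shows "K_derivation w"
proof -
  \<comment> \<open>Hence \<open>s\<^sub>+\<close> and \<open>s\<^sub>-\<close> are brackets of elements of degree \<open>1\<close> and \<open>-1\<close>.\<close>
  have half: "\<psi> ((1/2) *s s) \<one> = s" if "s \<in> Skew" for s
  proof -
    have "\<psi> ((1/2) *s s) \<one> = (1/2) *s s + (1/2) *s s"
      using that by (simp add: \<psi>_def Skew_def mult_one one_mult cnj_scale)
    then show ?thesis using two by (simp flip: scale_left_distrib)
  qed
  have z: "act_minus1 0 = 0" "V x 0 = 0" for x by (simp_all add: fun_eq_iff)
  have s: "K_derivation (0, 0, 0, 0, s)" if "s \<in> Skew" for s
    using K_derivation_bracket[OF K_derivation_plus1[of "(1/2) *s s"] K_derivation_plus1[of \<one>]] that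
    by (simp add: half zero_fun_def[symmetric])
  have t: "K_derivation (t, 0, 0, 0, 0)" if "t \<in> Skew" for t
    using K_derivation_bracket[OF K_derivation_minus1[of "(1/2) *s t"] K_derivation_minus1[of \<one>]] that
    by (simp add: half zero_fun_def[symmetric])
  have D: "K_derivation (0, 0, D, 0, 0)" if "D \<in> Instrl" for D
    using that
  proof (induction rule: Instrl_induct)
    case (V a b)
    show ?case using K_derivation_bracket[OF K_derivation_plus1[of a] K_derivation_minus1[of b]] by simp
  next
    case (add f g)
    then show ?case using K_derivation_add[OF add(3,4)] by (simp del: plus_fun_apply)
  next
    case (scale c f)
    then show ?case using K_derivation_scale[of "(0, 0, f, 0, 0)" c] by simp
  qed
  obtain t y D p s where w: "w = (t, y, D, p, s)" "t \<in> Skew" "D \<in> Instrl" "s \<in> Skew"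
    using assms by (rule K_carrierE)
  have "w = (t, 0, 0, 0, 0) + (0, y, 0, 0, 0) + (0, 0, D, 0, 0) + (0, 0, 0, p, 0) + (0, 0, 0, 0, s)"
    using w(1) by simp
  then show ?thesis
    using s[OF w(4)] t[OF w(2)] D[OF w(3)] K_derivation_plus1[of p] K_derivation_minus1[of y]
    by (simp only: K_derivation_add)
qed

lemma vector_space_K_scale: "vector_space K_scale"
  by unfold_locales
    (auto simp: fun_eq_iff fun_scale_apply scale_right_distrib scale_left_distrib)

lemma graded_carrier_K: "graded_carrier K_grading = K_carrier"
proof -
  have 5: "{-2..2} = {-2,-1,0,1,2::int}" by auto
  have "z \<in> K_carrier" if z: "z \<in> graded_carrier K_grading" for z
  proof -
    obtain f where f: "\<forall>i\<in>{-2..2}. f i \<in> K_grading i" "z = (\<Sum>i=-2..2. f i)"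
      using z by (auto simp: graded_carrier_def)
    have "f i \<in> K_carrier" if "i \<in> {-2..2}" for i
      using f(1) that by (auto simp: K_grading_def 5)
    then show ?thesis unfolding f(2) by (simp add: 5)
  qed
  moreover have "z \<in> graded_carrier K_grading" if z: "z \<in> K_carrier" for z
  proof -
    obtain t y D p s where w: "z = (t, y, D, p, s)" "t \<in> Skew" "D \<in> Instrl" "s \<in> Skew"
      using z by (rule K_carrierE)
    define f :: "int \<Rightarrow> 'a \<times> 'a \<times> ('a \<Rightarrow> 'a) \<times> 'a \<times> 'a" where "f i = (if i = -2 then (t, 0, 0, 0, 0)
      else if i = -1 then (0, y, 0, 0, 0) else if i = 0 then (0, 0, D, 0, 0) else if i = 1 then (0, 0, 0, p, 0)
      else (0, 0, 0, 0, s))" for i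
    have "\<forall>i\<in>{-2..2}. f i \<in> K_grading i" using w by (simp add: 5 f_def K_grading_def)
    moreover have "z = (\<Sum>i=-2..2. f i)" using w by (simp add: 5 f_def)
    ultimately show ?thesis unfolding graded_carrier_def by blast
  qed
  ultimately show ?thesis by blast
qed

lemma K_grading_iff:
  "(t, y, D, x, s) \<in> K_grading i \<longleftrightarrow> t \<in> Skew \<and> D \<in> Instrl \<and> s \<in> Skew \<and>
    (i \<noteq> -2 \<longrightarrow> t = 0) \<and> (i \<noteq> -1 \<longrightarrow> y = 0) \<and> (i \<noteq> 0 \<longrightarrow> D = 0) \<and> (i \<noteq> 1 \<longrightarrow> x = 0) \<and> (i \<noteq> 2 \<longrightarrow> s = 0)"
  by (auto simp: K_grading_def zero_prod_def)

lemma K_bracket_grading: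
  assumes "u \<in> K_grading i" "v \<in> K_grading j"
  shows "K_bracket u v \<in> K_grading (i + j)"
proof -
  obtain t y D p s where u: "u = (t, y, D, p, s)" by (cases u)
  obtain t' y' D' p' s' where v: "v = (t', y', D', p', s')" by (cases v)
  note mem = assms[unfolded u v K_grading_iff]
  have [simp]: "t \<in> Skew" "D \<in> Instrl" "s \<in> Skew" "t' \<in> Skew" "D' \<in> Instrl" "s' \<in> Skew"
    using mem by blast+
  have closed: "K_bracket u v \<in> K_carrier" by (intro K_bracket_closed) (simp_all add: u v)
  have orth: "P \<or> Q" if "i \<noteq> a \<longrightarrow> P" "j \<noteq> b \<longrightarrow> Q" "i + j \<noteq> a + b" for a b P Q
    using that by auto
  have z0: "(D = 0 \<or> t' = 0) \<and> (t = 0 \<or> D' = 0) \<and> (y = 0 \<or> y' = 0)" if "i + j \<noteq> -2"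
    using mem(1,2) that orth[of 0 "D = 0" "-2" "t' = 0"]
      orth[of "-2" "t = 0" 0 "D' = 0"]
      orth[of "-1" "y = 0" "-1" "y' = 0"]
    by simp
  have z1: "(D = 0 \<or> y' = 0) \<and> (y = 0 \<or> D' = 0) \<and> (t = 0 \<or> p' = 0) \<and> (p = 0 \<or> t' = 0)" if "i + j \<noteq> -1"
    using mem(1,2) that orth[of 0 "D = 0" "-1" "y' = 0"]
      orth[of "-1" "y = 0" 0 "D' = 0"]
      orth[of "-2" "t = 0" 1 "p' = 0"]
      orth[of 1 "p = 0" "-2" "t' = 0"]
    by simp
  have z2: "(D = 0 \<or> D' = 0) \<and> (p = 0 \<or> y' = 0) \<and> (y = 0 \<or> p' = 0) \<and> (s = 0 \<or> t' = 0) \<and> (t = 0 \<or> s' = 0)" if "i + j \<noteq> 0"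
    using mem(1,2) that orth[of 0 "D = 0" 0 "D' = 0"]
      orth[of 1 "p = 0" "-1" "y' = 0"]
      orth[of "-1" "y = 0" 1 "p' = 0"]
      orth[of 2 "s = 0" "-2" "t' = 0"]
      orth[of "-2" "t = 0" 2 "s' = 0"]
    by simp
  have z3: "(D = 0 \<or> p' = 0) \<and> (p = 0 \<or> D' = 0) \<and> (s = 0 \<or> y' = 0) \<and> (y = 0 \<or> s' = 0)" if "i + j \<noteq> 1"
    using mem(1,2) that orth[of 0 "D = 0" 1 "p' = 0"]
      orth[of 1 "p = 0" 0 "D' = 0"]
      orth[of 2 "s = 0" "-1" "y' = 0"]
      orth[of "-1" "y = 0" 2 "s' = 0"]
    by simp
  have z4: "(D = 0 \<or> s' = 0) \<and> (s = 0 \<or> D' = 0) \<and> (p = 0 \<or> p' = 0)" if "i + j \<noteq> 2"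
    using mem(1,2) that orth[of 0 "D = 0" 2 "s' = 0"]
      orth[of 2 "s = 0" 0 "D' = 0"]
      orth[of 1 "p = 0" 1 "p' = 0"]
    by simp
  have "act_minus2 D t' - act_minus2 D' t + \<psi> y y' = 0" if "i + j \<noteq> -2"
    using z0[OF that] by auto
  moreover have "act_minus1 D y' - act_minus1 D' y + t \<cdot> p' - t' \<cdot> p = 0" if "i + j \<noteq> -1"
    using z1[OF that] by auto
  moreover have "D (D' z) - D' (D z) + V p y' z - V p' y z + s \<cdot> (t' \<cdot> z) - s' \<cdot> (t \<cdot> z) = 0" if "i + j \<noteq> 0" for z
    using z2[OF that] by (auto simp: Instrl_linear_derived)
  moreover have "D p' - D' p + s \<cdot> y' - s' \<cdot> y = 0" if "i + j \<noteq> 1"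
    using z3[OF that] by (auto simp: Instrl_linear_derived)
  moreover have "act_plus2 D s' - act_plus2 D' s + \<psi> p p' = 0" if "i + j \<noteq> 2"
    using z4[OF that] by auto
  ultimately show ?thesis
    using closed unfolding u v K_bracket.simps K_carrier_iff K_grading_iff by (simp add: fun_eq_iff)
qed

sublocale K: graded_lie_algebra_5 K_scale K_grading K_bracket
proof -
  interpret K: vector_space K_scale by (rule vector_space_K_scale)
  show "graded_lie_algebra_5 K_scale K_grading K_bracket"
  proof unfold_locales
    show "K.subspace (K_grading i)" for i
    proof (rule K.subspaceI)
      show "0 \<in> K_grading i" by (simp add: zero_prod_def K_grading_iff)
      show "u + v \<in> K_grading i" if "u \<in> K_grading i" "v \<in> K_grading i" for u v
        using that by (cases u; cases v) (auto simp: K_grading_iff simp del: plus_fun_apply)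
      show "K_scale c u \<in> K_grading i" if "u \<in> K_grading i" for c u
        using that by (cases u) (auto simp: K_grading_iff fun_eq_iff fun_scale_apply)
    qed
    show "K_grading i = {0}" if "i < -2 \<or> 2 < i" for i
      using that by (auto simp: K_grading_def)
    show "K_bracket a b \<in> K_grading (i + j)" if "a \<in> K_grading i" "b \<in> K_grading j" for a b i j
      using that by (rule K_bracket_grading)
    show "K_bracket a (K_bracket b c) = K_bracket (K_bracket a b) c + K_bracket b (K_bracket a c)"
      if "a \<in> graded_carrier K_grading" "b \<in> graded_carrier K_grading" "c \<in> graded_carrier K_grading" for a b c
      using K_derivation that unfolding graded_carrier_K K_derivation_def by blast
    show "K_bracket a b = - K_bracket b a"
      if "a \<in> graded_carrier K_grading" "b \<in> graded_carrier K_grading" for a b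
      using K_bracket_antisym that unfolding graded_carrier_K by blast
    show "K_bracket (a + b) c = K_bracket a c + K_bracket b c"
      if "a \<in> graded_carrier K_grading" "b \<in> graded_carrier K_grading" "c \<in> graded_carrier K_grading" for a b c
      using K_bracket_add_left that unfolding graded_carrier_K by blast
    show "K_bracket (K_scale r a) b = K_scale r (K_bracket a b)"
      if "a \<in> graded_carrier K_grading" "b \<in> graded_carrier K_grading" for r a b
      using K_bracket_scale_left that unfolding graded_carrier_K by blast
  qed (rule two three)+
qed

section \<open>Division algebras\<close>

text \<open>If \<open>V u v = id\<close>, the involution of \<open>Instrl\<close> maps \<open>id\<close> to \<open>- V v u\<close>, but also to \<open>id - 2 id = - id\<close>.\<close>

lemma V_id_commute:
  assumes "V u v = id"
  shows "V v u = id"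
proof -
  have "- V v u y = - y" for y
  proof -
    have "- V v u y = act_minus1 (V u v) y" by (simp add: act_minus1_V)
    also have "\<dots> = - y" unfolding act_minus1_eq[OF Instrl_closed(1)] unfolding assms
      by (simp add: one_mult mult_add_left)
    finally show ?thesis .
  qed
  then show ?thesis by (auto simp: fun_eq_iff)
qed

text \<open>The identity map, once it lies in \<open>Instrl\<close>, is the grading element of \<open>K(A)\<close>.\<close>

lemma K_grading_element:
  assumes "id \<in> Instrl" "z \<in> K_grading i"
  shows "K_bracket (0, 0, id, 0, 0) z = K_scale (of_int i) z"
proof -
  obtain t y D p s where z: "z = (t, y, D, p, s)" by (cases z)
  have E: "act_minus1 id y = - y" for y
    using act_minus1_eq[OF assms(1)] by (simp add: one_mult mult_add_left)
  have P: "act_plus2 id s = 2 *s s" if "s \<in> Skew" for s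
    using act_plus2_eq[OF assms(1) that] by (simp add: mult_one scale_left_distrib[of 1 1, simplified])
  have M: "act_minus2 id t = - (2 *s t)" if "t \<in> Skew" for t
  proof -
    have "act_plus2 (fun_scale (-1) id) t = - (2 *s t)"
      using act_plus2_scale(1)[OF assms(1) that, of "-1"] P[OF that] by simp
    moreover have "act_minus1 id = fun_scale (-1) id" by (simp add: fun_eq_iff E fun_scale_apply)
    ultimately show ?thesis using act_minus2_eq[OF assms(1) that] by simp
  qed
  show ?thesis
    using assms unfolding z K_grading_iff
    by (auto simp: fun_eq_iff fun_scale_apply E P M Instrl_linear_derived)
qed

theorem algebraicI:
  assumes division
  shows algebraic
  unfolding algebraic_def
proof (rule K.algebraic_5_gradedI)
  fix u assume "u \<in> K_grading 1" "u \<noteq> 0"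
  then obtain x where u: "u = (0, 0, 0, x, 0)" "x \<noteq> 0" by (cases u) (auto simp: K_grading_iff zero_prod_def)
  then obtain y where y: "V x y = id" using assms by (auto simp: division_def conj_invertible_def)
  have id: "id \<in> Instrl" using Instrl_closed(1)[of x y] y by simp
  have e: "K_bracket u (0, y, 0, 0, 0) = (0, 0, id, 0, 0)" using u y by (simp add: id_def)
  have "\<forall>i. \<forall>z\<in>K_grading i. K_bracket (K_bracket u (0, y, 0, 0, 0)) z = K_scale (of_int i) z"
    unfolding e using K_grading_element[OF id] by blast
  moreover have "(0, y, 0, 0, 0) \<in> K_grading (-1)" by (simp add: K_grading_iff)
  ultimately show "\<exists>y\<in>K_grading (-1). \<forall>i. \<forall>z\<in>K_grading i. K_bracket (K_bracket u y) z = K_scale (of_int i) z"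
    by blast
next
  fix u assume "u \<in> K_grading (-1)" "u \<noteq> 0"
  then obtain x where u: "u = (0, x, 0, 0, 0)" "x \<noteq> 0" by (cases u) (auto simp: K_grading_iff zero_prod_def)
  then obtain y where "V x y = id" using assms by (auto simp: division_def conj_invertible_def)
  then have y: "V y x = id" by (rule V_id_commute)
  have id: "id \<in> Instrl" using Instrl_closed(1)[of y x] y by simp
  have e: "K_bracket u (0, 0, 0, y, 0) = K_scale (-1) (0, 0, id, 0, 0)"
    using u y by (simp add: fun_eq_iff fun_scale_apply)
  have "K_bracket (K_scale (-1) (0, 0, id, 0, 0)) z = K_scale (of_int (- i)) z"
    if z: "z \<in> K_grading i" for i z
  proof -
    have "z \<in> K_carrier" using K.Lg_subset[OF z] by (simp add: graded_carrier_K)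
    then have "K_bracket (K_scale (-1) (0, 0, id, 0, 0)) z = K_scale (-1) (K_scale (of_int i) z)"
      using K_bracket_scale_left[of "(0, 0, id, 0, 0)" z "-1"] K_grading_element[OF id z] id
      by (simp del: K_scale.simps K_bracket.simps)
    then show ?thesis by (simp del: K_scale.simps K_bracket.simps)
  qed
  then have "\<forall>i. \<forall>z\<in>K_grading i. K_bracket (K_bracket u (0, 0, 0, y, 0)) z = K_scale (of_int (- i)) z"
    unfolding e by blast
  moreover have "(0, 0, 0, y, 0) \<in> K_grading 1" by (simp add: K_grading_iff)
  ultimately show "\<exists>y\<in>K_grading 1. \<forall>i. \<forall>z\<in>K_grading i. K_bracket (K_bracket u y) z = K_scale (of_int (- i)) z"
    by blast
qed

end

theorem theorem4p2p8:
  fixes scale :: "'k::field \<Rightarrow> 'a::ab_group_add \<Rightarrow> 'a"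
    and mult :: "'a \<Rightarrow> 'a \<Rightarrow> 'a"
    and one :: 'a
    and cnj :: "'a \<Rightarrow> 'a"
  assumes "CHAR('k) \<noteq> 2" and "CHAR('k) \<noteq> 3"
    and "central_simple_structurable_division_algebra scale mult one cnj"
  shows "algebra_with_involution.algebraic scale mult cnj"
proof -
  interpret central_simple_structurable_division_algebra scale mult one cnj by fact
  have small: "n = 1 \<or> n = p" if "n dvd p" "p = 2 \<or> p = 3" for n p :: nat
  proof -
    have "n \<le> 3" "n \<noteq> 0" using that dvd_imp_le[of n p] by (auto intro!: Nat.gr0I)
    then have "n = 1 \<or> n = 2 \<or> n = 3" by linarith
    then show ?thesis using that by (elim disjE) simp_all
  qed
  have nonzero: "of_nat p \<noteq> (0::'k)" if "CHAR('k) \<noteq> p" "p = 2 \<or> p = 3" for p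
    using small[OF _ that(2), of "CHAR('k)"] that(1) CHAR_not_1[where ?'a = 'k]
    unfolding of_nat_eq_0_iff_char_dvd One_nat_def by blast
  have char: "(2::'k) \<noteq> 0" "(3::'k) \<noteq> 0"
    using nonzero[OF assms(1)] nonzero[OF assms(2)] by simp_all
  interpret structurable_algebra_char scale mult one cnj
    by unfold_locales (fact char)+
  show ?thesis by (rule algebraicI) (rule division)
qed

end
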